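(* Let $n,t\ge 1$ and $d\ge 2$ be integers, let $v=x_{j_1}x_{j_2}\cdots x_{j_d}$ (with $j_1<j_2<\dots<j_d$) be a $t$-spread monomial of degree $d$ of $S=K[x_1,\dots,x_n]$ with $j_1\ge 2$, and let $J=(\mathcal{L}_t^i(v))$ be the initial $t$-spread lexsegment ideal of $S$ determined by $v$. Then the standard primary decomposition of $J$ is $$J=\bigcap_{p=1}^d\mathfrak{p}_{F_p}\cap\bigcap_{F\in\mathcal{F}}\mathfrak{p}_{[n]\setminus F},$$ where $$F_p=[j_p]\setminus\mathrm{supp}_t(x_{j_1}x_{j_2}\cdots x_{j_{p-1}}),\qquad p=1,\dots,d,$$ $$\mathcal{F}=\big\{\mathrm{supp}_t(w): w\in M_{n+1-t,d-1,t},\ w>_{\mathrm{slex}}v/x_{\max(v)}\big\}.$$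
   Context: $S=K[x_1,\dots,x_n]$ is a polynomial ring over a field $K$, and $[m]=\{1,\dots,m\}$. For integers $a,b$, $[a,b]=\{\ell: a\le\ell\le b\}$. For a monomial $w$, $\max(w)$ and $\min(w)$ are the largest and smallest index of a variable dividing $w$. For $t\ge1$, a monomial $x_{i_1}\cdots x_{i_d}$ with $i_1\le\dots\le i_d$ is $t$-spread if $i_{r+1}-i_r\ge t$ for $r=1,\dots,d-1$. $M_{m,d,t}$ is the set of $t$-spread monomials of degree $d$ in the variables $x_1,\dots,x_m$. For squarefree monomials of the same degree, $x_{i_1}\cdots x_{i_d}>_{\mathrm{slex}}x_{j_1}\cdots x_{j_d}$ (indices increasing) if for some $s$ one has $i_1=j_1,\dots,i_{s-1}=j_{s-1}$ and $i_s<j_s$. For $v\in M_{n,d,t}$, $\mathcal{L}_t^i(v)=\{w\in M_{n,d,t}: w\ge_{\mathrm{slex}}v\}$, and $(\mathcal{L}_t^i(v))$ is the ideal of $S$ it generates. For a $t$-spread monomial $w=x_{\ell_1}\cdots x_{\ell_k}$ with $\max(w)\le n+1-t$, $\mathrm{supp}_t(w)=\bigcup_{r=1}^k[\ell_r,\ell_r+(t-1)]$, and $\mathrm{supp}_t(1)=\emptyset$. For $A\subseteq[n]$, $\mathfrak{p}_A=(x_i:i\in A)$. The standard primary decomposition of a squarefree monomial ideal $I$ is its unique minimal (irredundant) primary decomposition $I=\bigcap_{\mathfrak{p}\in\mathrm{Min}(I)}\mathfrak{p}$, where $\mathrm{Min}(I)$ is the set of minimal primes of $I$; so the primes displayed are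 exactly the minimal primes of $J$. *)

theory Defs
  imports "HOL-Algebra.Ideal" "HOL-Library.Poly_Mapping"
begin

section \<open>Monomials\<close>

text \<open>A monomial is given by its exponent vector; in particular \<open>0\<close> is the monomial \<open>1\<close> and
  products of monomials are sums of exponent vectors.\<close>

type_synonym monomial = "nat \<Rightarrow>\<^sub>0 nat"

text \<open>The monomial \<open>x\<^bsub>i 1\<^esub> \<cdots> x\<^bsub>i k\<^esub>\<close>; index sequences are numbered from 1.\<close>

definition xprod :: "(nat \<Rightarrow> nat) \<Rightarrow> nat \<Rightarrow> monomial" where
  "xprod i k = (\<Sum>r = 1..k. Poly_Mapping.single (i r) 1)"

definition mon_degree :: "monomial \<Rightarrow> nat" where
  "mon_degree u = (\<Sum>i \<in> Poly_Mapping.keys u. Poly_Mapping.lookup u i)"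

definition max_index :: "monomial \<Rightarrow> nat" where
  "max_index u = Max (Poly_Mapping.keys u)"

definition t_spread :: "nat \<Rightarrow> monomial \<Rightarrow> bool" where
  "t_spread t u \<longleftrightarrow>
     (\<exists>k i. u = xprod i k \<and> (\<forall>r \<in> {1..<k}. i r \<le> i (Suc r) \<and> i r + t \<le> i (Suc r)))"

definition spread_monomials :: "nat \<Rightarrow> nat \<Rightarrow> nat \<Rightarrow> monomial set" where
  "spread_monomials m d t =
     {u. t_spread t u \<and> mon_degree u = d \<and> Poly_Mapping.keys u \<subseteq> {1..m}}"

text \<open>The strict order \<open>u >\<^sub>s\<^sub>l\<^sub>e\<^sub>x w\<close>, relating only squarefree monomials of the same degree.\<close>

definition slex_gt :: "monomial \<Rightarrow> monomial \<Rightarrow> bool" where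
  "slex_gt u w \<longleftrightarrow>
     (\<exists>k i j. u = xprod i k \<and> w = xprod j k
        \<and> strict_mono_on {1..k} i \<and> strict_mono_on {1..k} j
        \<and> (\<exists>s \<in> {1..k}. (\<forall>r \<in> {1..<s}. i r = j r) \<and> i s < j s))"

definition init_lexsegment :: "nat \<Rightarrow> nat \<Rightarrow> nat \<Rightarrow> monomial \<Rightarrow> monomial set" where
  "init_lexsegment n d t v = {w \<in> spread_monomials n d t. w = v \<or> slex_gt w v}"

definition supp_t :: "nat \<Rightarrow> monomial \<Rightarrow> nat set" where
  "supp_t t w = (\<Union>l \<in> Poly_Mapping.keys w. {l..l + (t - 1)})"


section \<open>The polynomial ring in \<open>x\<^sub>1, \<dots>, x\<^sub>n\<close>\<close>

text \<open>The type \<open>monomial \<Rightarrow>\<^sub>0 'k\<close> is the polynomial ring over \<open>'k\<close> in the variables \<open>x\<^sub>i\<close> with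
  \<open>i\<close> any natural number; \<open>K[x\<^sub>1, \<dots>, x\<^sub>n]\<close> is its subring of the polynomials that
  involve only variables with index in \<open>{1..n}\<close>.\<close>

definition poly_ring :: "nat \<Rightarrow> (monomial \<Rightarrow>\<^sub>0 'k::field) ring" where
  "poly_ring n =
     \<lparr>carrier = {f. \<forall>u \<in> Poly_Mapping.keys f. Poly_Mapping.keys u \<subseteq> {1..n}},
      mult = (*), one = 1, zero = 0, add = (+)\<rparr>"

definition mon_poly :: "monomial \<Rightarrow> (monomial \<Rightarrow>\<^sub>0 'k::field)" where
  "mon_poly u = Poly_Mapping.single u 1"

definition monomial_ideal :: "(monomial \<Rightarrow>\<^sub>0 'k::field) ring \<Rightarrow> monomial set \<Rightarrow> (monomial \<Rightarrow>\<^sub>0 'k) set"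
  where "monomial_ideal S U = Idl\<^bsub>S\<^esub> (mon_poly ` U)"

definition var_ideal :: "(monomial \<Rightarrow>\<^sub>0 'k::field) ring \<Rightarrow> nat set \<Rightarrow> (monomial \<Rightarrow>\<^sub>0 'k) set" where
  "var_ideal S A = Idl\<^bsub>S\<^esub> ((\<lambda>i. mon_poly (Poly_Mapping.single i 1)) ` A)"


section \<open>Primary decompositions\<close>

definition ideal_radical :: "('a, 'm) ring_scheme \<Rightarrow> 'a set \<Rightarrow> 'a set" where
  "ideal_radical R I = {a \<in> carrier R. \<exists>k::nat. 0 < k \<and> a [^]\<^bsub>R\<^esub> k \<in> I}"

definition primary_ideal :: "('a, 'm) ring_scheme \<Rightarrow> 'a set \<Rightarrow> bool" where
  "primary_ideal R I \<longleftrightarrow>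
     ideal I R \<and> I \<noteq> carrier R \<and>
     (\<forall>a \<in> carrier R. \<forall>b \<in> carrier R.
        a \<otimes>\<^bsub>R\<^esub> b \<in> I \<longrightarrow> a \<in> I \<or> b \<in> ideal_radical R I)"

definition minimal_primes :: "('a, 'm) ring_scheme \<Rightarrow> 'a set \<Rightarrow> 'a set set" where
  "minimal_primes R I =
     {P. primeideal P R \<and> I \<subseteq> P \<and> (\<forall>Q. primeideal Q R \<and> I \<subseteq> Q \<and> Q \<subseteq> P \<longrightarrow> Q = P)}"

text \<open>The family \<open>Q\<close> indexed by \<open>A\<close> is a minimal (irredundant) primary decomposition of \<open>I\<close>. The
  intersection with the carrier makes the empty intersection the whole ring.\<close>

definition minimal_primary_decomposition ::
    "('a, 'm) ring_scheme \<Rightarrow> 'a set \<Rightarrow> 'b set \<Rightarrow> ('b \<Rightarrow> 'a set) \<Rightarrow> bool" where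
  "minimal_primary_decomposition R I A Q \<longleftrightarrow>
     finite A \<and> (\<forall>a \<in> A. primary_ideal R (Q a)) \<and>
     I = carrier R \<inter> (\<Inter>a \<in> A. Q a) \<and>
     (\<forall>a \<in> A. \<not> carrier R \<inter> (\<Inter>b \<in> A - {a}. Q b) \<subseteq> Q a) \<and>
     inj_on (\<lambda>a. ideal_radical R (Q a)) A"

definition standard_primary_decomposition ::
    "('a, 'm) ring_scheme \<Rightarrow> 'a set \<Rightarrow> 'b set \<Rightarrow> ('b \<Rightarrow> 'a set) \<Rightarrow> bool" where
  "standard_primary_decomposition R I A Q \<longleftrightarrow>
     minimal_primary_decomposition R I A Q \<and> Q ` A = minimal_primes R I"

end

theory Submission
  imports Defs
begin

text \<open>The minimal primes of a squarefree monomial ideal are generated by the minimal covers, the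
  minimal sets of variables meeting the support of every generator. Each set in the theorem is a
  minimal cover: a block \<open>[l, l + t - 1]\<close> contains at most one variable of a \<open>t\<close>-spread monomial, and
  when a variable \<open>x\<close> is dropped from the cover, left ends of the blocks before \<open>x\<close>, then \<open>x\<close>, then
  right ends of the blocks after \<open>x\<close> give a generator that the smaller set misses. Conversely, cover
  the complement of a given cover greedily by blocks starting at \<open>a\<^sub>1 < a\<^sub>2 < \<dots>\<close> and compare this
  sequence with \<open>j\<close> at the first index \<open>p\<close> where they differ: if \<open>a\<^sub>p > j\<^sub>p\<close>, the cover contains \<open>F\<^sub>p\<close>; if
  \<open>p < d\<close> and \<open>a\<^sub>p < j\<^sub>p\<close>, then \<open>d - 1\<close> blocks suffice, since a further element would give a generator
  that the cover misses.\<close>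

section \<open>Monomial ideals\<close>

lemma poly_ring_simps [simp]:
  "carrier (poly_ring n) = {f. \<forall>u \<in> Poly_Mapping.keys f. Poly_Mapping.keys u \<subseteq> {1..n}}"
  "f \<otimes>\<^bsub>poly_ring n\<^esub> g = f * g" "f \<oplus>\<^bsub>poly_ring n\<^esub> g = f + g"
  "\<one>\<^bsub>poly_ring n\<^esub> = 1" "\<zero>\<^bsub>poly_ring n\<^esub> = 0"
  by (simp_all add: poly_ring_def)

lemma keys_uminus: "Poly_Mapping.keys (- f) = Poly_Mapping.keys (f :: 'a \<Rightarrow>\<^sub>0 'b::ab_group_add)"
  by (auto simp: in_keys_iff)

lemma keys_add_nat:
  "Poly_Mapping.keys (u + w) = Poly_Mapping.keys u \<union> Poly_Mapping.keys (w :: 'a \<Rightarrow>\<^sub>0 nat)"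
  by (auto simp: in_keys_iff lookup_add)

lemma carrier_poly_ring_mult:
  fixes f g :: "monomial \<Rightarrow>\<^sub>0 'k::field"
  assumes "f \<in> carrier (poly_ring n)" "g \<in> carrier (poly_ring n)"
  shows "f * g \<in> carrier (poly_ring n)"
  using assms keys_mult[of f g] by (fastforce simp: keys_add_nat)

lemma carrier_poly_ring_add:
  fixes f g :: "monomial \<Rightarrow>\<^sub>0 'k::field"
  assumes "f \<in> carrier (poly_ring n)" "g \<in> carrier (poly_ring n)"
  shows "f + g \<in> carrier (poly_ring n)"
  using assms keys_add[of f g] by fastforce

lemma cring_poly_ring: "cring (poly_ring n :: (monomial \<Rightarrow>\<^sub>0 'k::field) ring)"
proof (rule cringI)
  show "abelian_group (poly_ring n :: (monomial \<Rightarrow>\<^sub>0 'k) ring)"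
  proof (rule abelian_groupI)
    fix f :: "monomial \<Rightarrow>\<^sub>0 'k" assume "f \<in> carrier (poly_ring n)"
    then show "\<exists>g \<in> carrier (poly_ring n). g \<oplus>\<^bsub>poly_ring n\<^esub> f = \<zero>\<^bsub>poly_ring n\<^esub>"
      by (intro bexI[of _ "- f"]) (simp_all add: keys_uminus)
  qed (use carrier_poly_ring_add[of _ n] in \<open>simp_all add: ac_simps\<close>)
  show "Group.comm_monoid (poly_ring n :: (monomial \<Rightarrow>\<^sub>0 'k) ring)"
    by (rule comm_monoidI) (use carrier_poly_ring_mult[of _ n] in \<open>simp_all add: ac_simps\<close>)
qed (simp add: algebra_simps)

section \<open>Ideals generated by monomials and by variables\<close>

lemma poly_mapping_sum_singles:
  "f = (\<Sum>u \<in> Poly_Mapping.keys f. Poly_Mapping.single u (Poly_Mapping.lookup f u))"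
proof (rule poly_mapping_eqI)
  fix u
  show "Poly_Mapping.lookup f u =
    Poly_Mapping.lookup (\<Sum>u \<in> Poly_Mapping.keys f. Poly_Mapping.single u (Poly_Mapping.lookup f u)) u"
    by (auto simp: lookup_sum lookup_single when_def sum.delta in_keys_iff)
qed

text \<open>Absorption of multiples supplies additive inverses, since the constant
  \<open>- 1\<close> lies in the ring.\<close>

lemma ideal_poly_ringI:
  fixes I :: "(monomial \<Rightarrow>\<^sub>0 'k::field) set"
  assumes "I \<subseteq> carrier (poly_ring n)" "0 \<in> I"
    and add: "\<And>f g. f \<in> I \<Longrightarrow> g \<in> I \<Longrightarrow> f + g \<in> I"
    and mult: "\<And>f g. f \<in> carrier (poly_ring n) \<Longrightarrow> g \<in> I \<Longrightarrow> f * g \<in> I"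
  shows "ideal I (poly_ring n)"
proof (rule idealI)
  interpret R: cring "poly_ring n :: (monomial \<Rightarrow>\<^sub>0 'k) ring"
    by (rule cring_poly_ring)
  show "ring (poly_ring n :: (monomial \<Rightarrow>\<^sub>0 'k) ring)" ..
  have m1: "- 1 \<in> carrier (poly_ring n :: (monomial \<Rightarrow>\<^sub>0 'k) ring)"
    by (simp add: keys_uminus)
  show "subgroup I (add_monoid (poly_ring n))"
  proof (rule R.add.subgroupI)
    fix f assume f: "f \<in> I"
    then have "- f \<in> I" using mult[OF m1 f] by simp
    moreover have "- f = \<ominus>\<^bsub>poly_ring n\<^esub> f"
    proof (rule R.minus_equality[symmetric])
      show "- f \<in> carrier (poly_ring n)" "f \<in> carrier (poly_ring n)"
        using assms(1) f \<open>- f \<in> I\<close> by blast+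
    qed simp
    ultimately show "\<ominus>\<^bsub>poly_ring n\<^esub> f \<in> I" by simp
  qed (use assms in \<open>auto simp del: poly_ring_simps(1)\<close>)
next
  fix f g assume "f \<in> I" "g \<in> carrier (poly_ring n :: (monomial \<Rightarrow>\<^sub>0 'k) ring)"
  then show "g \<otimes>\<^bsub>poly_ring n\<^esub> f \<in> I" "f \<otimes>\<^bsub>poly_ring n\<^esub> g \<in> I"
    using mult[of g f] by (simp_all add: mult.commute del: poly_ring_simps(1))
qed

text \<open>The right-hand side is an ideal containing the generators. Conversely, each of its
  elements is the sum of its terms, and every term is a multiple of a generator.\<close>

lemma monomial_ideal_eq:
  fixes U :: "monomial set"
  assumes U: "\<And>m. m \<in> U \<Longrightarrow> Poly_Mapping.keys m \<subseteq> {1..n}"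
  shows "monomial_ideal (poly_ring n :: (monomial \<Rightarrow>\<^sub>0 'k::field) ring) U =
    {f \<in> carrier (poly_ring n). \<forall>u \<in> Poly_Mapping.keys f. \<exists>m \<in> U. \<exists>w. u = w + m}"
    (is "?J = ?M")
proof
  let ?R = "poly_ring n :: (monomial \<Rightarrow>\<^sub>0 'k) ring"
  interpret R: cring ?R by (rule cring_poly_ring)
  have UC: "mon_poly ` U \<subseteq> carrier ?R"
    using U by (simp add: mon_poly_def image_subset_iff)
  have "ideal ?M ?R"
  proof (rule ideal_poly_ringI)
    fix f g assume "f \<in> ?M" "g \<in> ?M"
    then show "f + g \<in> ?M"
      using keys_add[of f g] carrier_poly_ring_add[of f n g] by blast
  next
    fix f g assume fg: "f \<in> carrier ?R" "g \<in> ?M"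
    have "\<exists>m \<in> U. \<exists>w. u = w + m" if u: "u \<in> Poly_Mapping.keys (f * g)" for u
    proof -
      obtain a b where "u = a + b" "b \<in> Poly_Mapping.keys g"
        using keys_mult[of f g] u by blast
      moreover then obtain m w where "m \<in> U" "b = w + m" using fg(2) by blast
      ultimately show ?thesis by (metis add.assoc)
    qed
    then show "f * g \<in> ?M"
      using fg carrier_poly_ring_mult[of f n g] by blast
  qed auto
  moreover have "mon_poly ` U \<subseteq> ?M"
  proof -
    have "\<exists>m \<in> U. \<exists>w. u = w + m" if "u \<in> U" for u
      using that by (metis add.left_neutral)
    then show ?thesis
      using UC by (auto simp: mon_poly_def)
  qed
  ultimately show "?J \<subseteq> ?M"
    unfolding monomial_ideal_def by (rule R.genideal_minimal)
  have J: "ideal ?J ?R"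
    unfolding monomial_ideal_def by (rule R.genideal_ideal[OF UC])
  then interpret J: ideal ?J ?R .
  have sum: "(\<Sum>u \<in> A. h u) \<in> ?J" if "finite A" "\<And>u. u \<in> A \<Longrightarrow> h u \<in> ?J" for A and h :: "monomial \<Rightarrow> _"
    using that
  proof (induction A rule: finite_induct)
    case empty
    then show ?case using J.zero_closed by simp
  next
    case (insert u A)
    then show ?case using J.a_closed[of "h u" "sum h A"] by simp
  qed
  have single: "Poly_Mapping.single u c \<in> ?J"
    if m: "m \<in> U" and u: "u = w + m" "Poly_Mapping.keys u \<subseteq> {1..n}" for u w m c
  proof -
    have "mon_poly m \<in> ?J"
      unfolding monomial_ideal_def using m R.genideal_self[OF UC] by blast
    \<comment> \<open>Exponents cannot cancel, so the cofactor \<open>w\<close> involves only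
      variables of \<open>u\<close> and stays in the ring.\<close>
    moreover have "Poly_Mapping.single w c \<in> carrier ?R"
      using u by (auto simp: keys_add_nat)
    ultimately have "Poly_Mapping.single w c * mon_poly m \<in> ?J"
      using J.I_l_closed by fastforce
    then show ?thesis by (simp add: mon_poly_def mult_single u)
  qed
  show "?M \<subseteq> ?J"
  proof
    fix f assume f: "f \<in> ?M"
    have "(\<Sum>u \<in> Poly_Mapping.keys f. Poly_Mapping.single u (Poly_Mapping.lookup f u)) \<in> ?J"
    proof (rule sum)
      fix u assume "u \<in> Poly_Mapping.keys f"
      then show "Poly_Mapping.single u (Poly_Mapping.lookup f u) \<in> ?J"
        using f single by fastforce
    qed simp
    then show "f \<in> ?J" by (simp flip: poly_mapping_sum_singles)
  qed
qed

text \<open>The case of \<open>monomial_ideal_eq\<close> with single variables as generators: a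
  variable divides \<open>u\<close> exactly when its index lies in the support of
  \<open>u\<close>.\<close>

lemma var_ideal_eq:
  assumes "A \<subseteq> {1..n}"
  shows "var_ideal (poly_ring n :: (monomial \<Rightarrow>\<^sub>0 'k::field) ring) A =
    {f \<in> carrier (poly_ring n). \<forall>u \<in> Poly_Mapping.keys f. Poly_Mapping.keys u \<inter> A \<noteq> {}}"
proof -
  have "(\<exists>i \<in> A. \<exists>w. u = w + Poly_Mapping.single i 1) \<longleftrightarrow> Poly_Mapping.keys u \<inter> A \<noteq> {}"
    for u :: monomial
  proof
    assume "Poly_Mapping.keys u \<inter> A \<noteq> {}"
    then obtain i where i: "i \<in> A" "i \<in> Poly_Mapping.keys u" by blast
    then have "u = (u - Poly_Mapping.single i 1) + Poly_Mapping.single i 1"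
      by (intro poly_mapping_eqI) (auto simp: lookup_add lookup_minus lookup_single when_def in_keys_iff)
    with i show "\<exists>i \<in> A. \<exists>w. u = w + Poly_Mapping.single i 1" by blast
  qed (auto simp: keys_add_nat)
  moreover have "var_ideal (poly_ring n :: (monomial \<Rightarrow>\<^sub>0 'k::field) ring) A =
    monomial_ideal (poly_ring n) ((\<lambda>i. Poly_Mapping.single i 1) ` A)"
    by (simp add: var_ideal_def monomial_ideal_def image_image)
  ultimately show ?thesis
    using assms by (subst (asm) monomial_ideal_eq) auto
qed

text \<open>Split off from \<open>f\<close> and \<open>g\<close> the terms that avoid the variables of \<open>A\<close>; the product of these
  parts also avoids them, yet lies in the ideal if \<open>f * g\<close> does, hence vanishes.\<close>

lemma var_ideal_prime:
  fixes n :: nat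
  assumes A: "A \<subseteq> {1..n}"
  shows "primeideal (var_ideal (poly_ring n :: (monomial \<Rightarrow>\<^sub>0 'k::field) ring) A) (poly_ring n)"
proof (rule primeidealI)
  let ?R = "poly_ring n :: (monomial \<Rightarrow>\<^sub>0 'k) ring"
  interpret R: cring ?R by (rule cring_poly_ring)
  define V where "V = {f :: monomial \<Rightarrow>\<^sub>0 'k. \<forall>u \<in> Poly_Mapping.keys f. Poly_Mapping.keys u \<inter> A \<noteq> {}}"
  have V: "var_ideal ?R A = carrier ?R \<inter> V"
    by (auto simp: var_ideal_eq[OF A] V_def)
  show "cring ?R" ..
  have "(\<lambda>i. mon_poly (Poly_Mapping.single i 1)) ` A \<subseteq> carrier ?R"
    using A by (auto simp: mon_poly_def)
  then show "ideal (var_ideal ?R A) ?R"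
    unfolding var_ideal_def by (rule R.genideal_ideal)
  have "1 \<in> carrier ?R - V" by (simp add: V_def)
  then show "carrier ?R \<noteq> var_ideal ?R A" using V by blast
  have V_mult: "f * g \<in> V" if "f \<in> V" for f g
    using that keys_mult[of f g] by (fastforce simp: V_def keys_add_nat)
  have V_diff: "f - g \<in> V" if "f \<in> V" "g \<in> V" for f g
    using that keys_add[of f "- g"] by (auto simp: V_def keys_uminus)
  fix f g :: "monomial \<Rightarrow>\<^sub>0 'k"
  assume fg: "f \<in> carrier ?R" "g \<in> carrier ?R" "f \<otimes>\<^bsub>?R\<^esub> g \<in> var_ideal ?R A"
  define \<phi> where "\<phi> h = (\<Sum>u \<in> {u \<in> Poly_Mapping.keys h. Poly_Mapping.keys u \<inter> A = {}}.
    Poly_Mapping.single u (Poly_Mapping.lookup h u))" for h :: "monomial \<Rightarrow>\<^sub>0 'k"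
  have \<phi>: "Poly_Mapping.lookup (\<phi> h) u = (if Poly_Mapping.keys u \<inter> A = {} then Poly_Mapping.lookup h u else 0)"
    for h u
    by (auto simp: \<phi>_def lookup_sum lookup_single when_def sum.delta in_keys_iff)
  have rest: "h - \<phi> h \<in> V" for h
    by (auto simp: V_def in_keys_iff lookup_minus \<phi> split: if_splits)
  have keys_\<phi>: "Poly_Mapping.keys u \<inter> A = {}" if "u \<in> Poly_Mapping.keys (\<phi> h)" for h u
    using that by (auto simp: in_keys_iff \<phi> split: if_splits)
  have "f * g \<in> V" using fg V by simp
  have "\<phi> f * \<phi> g = f * g - (f - \<phi> f) * g - (g - \<phi> g) * \<phi> f"
    by (simp add: algebra_simps)
  also have "\<dots> \<in> V"
    using \<open>f * g \<in> V\<close> rest by (blast intro: V_diff V_mult)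
  finally have "\<phi> f * \<phi> g \<in> V" .
  moreover have "Poly_Mapping.keys u \<inter> A = {}" if u: "u \<in> Poly_Mapping.keys (\<phi> f * \<phi> g)" for u
  proof -
    obtain a b where "u = a + b" "a \<in> Poly_Mapping.keys (\<phi> f)" "b \<in> Poly_Mapping.keys (\<phi> g)"
      using u keys_mult[of "\<phi> f" "\<phi> g"] by blast
    then show ?thesis
      using keys_\<phi>[of a f] keys_\<phi>[of b g] by (auto simp: keys_add_nat)
  qed
  ultimately have "Poly_Mapping.keys (\<phi> f * \<phi> g) = {}"
    unfolding V_def by blast
  then have "\<phi> f * \<phi> g = 0" by simp
  \<comment> \<open>Polynomials over a field have no zero divisors.\<close>
  then have "\<phi> f = 0 \<or> \<phi> g = 0" by simp
  then have "f \<in> V \<or> g \<in> V" using rest[of f] rest[of g] by auto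
  then show "f \<in> var_ideal ?R A \<or> g \<in> var_ideal ?R A"
    using fg V by blast
qed

section \<open>Prime ideals, radicals and minimal primes\<close>

lemma (in primeideal) pow_mem_imp_mem:
  assumes "a \<in> carrier R" "a [^] (k::nat) \<in> I"
  shows "a \<in> I"
  using assms(2)
proof (induction k)
  case 0
  then show ?case using I_notcarr one_imp_carrier by simp
next
  case (Suc k)
  then show ?case using assms(1) I_prime[of "a [^] k" a] by auto
qed

lemma (in primeideal) ideal_radical_eq: "ideal_radical R I = I"
proof
  show "I \<subseteq> ideal_radical R I"
  proof
    fix a assume a: "a \<in> I"
    then have "a [^] (1::nat) \<in> I" using Icarr by simp
    then show "a \<in> ideal_radical R I"
      unfolding ideal_radical_def using Icarr[OF a] zero_less_one by blast
  qed
qed (auto simp: ideal_radical_def intro: pow_mem_imp_mem)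

lemma primeideal_imp_primary_ideal:
  assumes "primeideal I R"
  shows "primary_ideal R I"
proof -
  interpret primeideal I R by fact
  show ?thesis
    unfolding primary_ideal_def ideal_radical_eq
    using is_ideal I_notcarr I_prime by blast
qed

text \<open>Induction on the degree: split one variable off \<open>m\<close>; primality puts either
  this variable or the cofactor into \<open>P\<close>.\<close>

lemma primeideal_mon_poly:
  fixes P :: "(monomial \<Rightarrow>\<^sub>0 'k::field) set"
  assumes "primeideal P (poly_ring n)"
    and "mon_poly m \<in> P" "Poly_Mapping.keys m \<subseteq> {1..n}"
  shows "\<exists>i \<in> Poly_Mapping.keys m. mon_poly (Poly_Mapping.single i 1) \<in> P"
  using assms(2,3)
proof (induction "\<Sum>i \<in> Poly_Mapping.keys m. Poly_Mapping.lookup m i" arbitrary: m rule: less_induct)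
  case less
  interpret primeideal P "poly_ring n" by fact
  have "m \<noteq> 0"
  proof
    assume "m = 0"
    then have "1 \<in> P" using less.prems(1) by (simp add: mon_poly_def)
    then show False using I_notcarr one_imp_carrier by simp
  qed
  then obtain i where i: "i \<in> Poly_Mapping.keys m" by (metis keys_eq_empty ex_in_conv)
  define m' where "m' = m - Poly_Mapping.single i 1"
  have m: "m = m' + Poly_Mapping.single i 1"
    using i unfolding m'_def
    by (intro poly_mapping_eqI) (auto simp: lookup_add lookup_minus lookup_single when_def in_keys_iff)
  have sub: "Poly_Mapping.keys m' \<subseteq> Poly_Mapping.keys m"
    unfolding m keys_add_nat by blast
  have "mon_poly m = mon_poly m' * (mon_poly (Poly_Mapping.single i 1) :: _ \<Rightarrow>\<^sub>0 'k)"
    by (simp add: mon_poly_def mult_single m)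
  then have "mon_poly m' \<otimes>\<^bsub>poly_ring n\<^esub> mon_poly (Poly_Mapping.single i 1) \<in> P"
    using less.prems(1) by simp
  moreover have "mon_poly m' \<in> carrier (poly_ring n)"
    "mon_poly (Poly_Mapping.single i 1) \<in> carrier (poly_ring n)"
    using less.prems(2) sub i by (auto simp: mon_poly_def)
  ultimately consider "mon_poly m' \<in> P" | "mon_poly (Poly_Mapping.single i 1) \<in> P"
    using I_prime by blast
  then show ?case
  proof cases
    case 1
    \<comment> \<open>Both degrees become sums over the same index set, where the summands differ at
      \<open>i\<close>.\<close>
    have "(\<Sum>i \<in> Poly_Mapping.keys m'. Poly_Mapping.lookup m' i) = (\<Sum>i \<in> Poly_Mapping.keys m. Poly_Mapping.lookup m' i)"
      by (rule sum.mono_neutral_left) (use sub in \<open>auto simp: in_keys_iff\<close>)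
    also have "\<dots> < (\<Sum>i \<in> Poly_Mapping.keys m. Poly_Mapping.lookup m i)"
      by (rule sum_strict_mono_ex1) (use i in \<open>auto simp: m lookup_add intro!: bexI[of _ i]\<close>)
    finally show ?thesis
      using less.hyps[of m'] 1 less.prems(2) sub by blast
  qed (use i in blast)
qed

text \<open>The hypotheses say that \<open>A\<close> enumerates the minimal covers without repetition.\<close>

lemma squarefree_standard_primary_decomposition:
  fixes n :: nat and U :: "monomial set" and A :: "'b \<Rightarrow> nat set"
  defines "R \<equiv> poly_ring n :: (monomial \<Rightarrow>\<^sub>0 'k::field) ring"
  assumes fin: "finite I"
    and U: "\<And>m. m \<in> U \<Longrightarrow> Poly_Mapping.keys m \<subseteq> {1..n}"
    and sqfree: "\<And>m x. m \<in> U \<Longrightarrow> Poly_Mapping.lookup m x \<le> 1"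
    and A: "\<And>a. a \<in> I \<Longrightarrow> A a \<subseteq> {1..n}"
    and cover: "\<And>a m. a \<in> I \<Longrightarrow> m \<in> U \<Longrightarrow> Poly_Mapping.keys m \<inter> A a \<noteq> {}"
    and covers_contain: "\<And>C. C \<subseteq> {1..n} \<Longrightarrow> (\<And>m. m \<in> U \<Longrightarrow> Poly_Mapping.keys m \<inter> C \<noteq> {}) \<Longrightarrow>
      \<exists>a \<in> I. A a \<subseteq> C"
    and incomparable: "\<And>a b. a \<in> I \<Longrightarrow> b \<in> I \<Longrightarrow> A a \<subseteq> A b \<Longrightarrow> a = b"
  shows "monomial_ideal R U = carrier R \<inter> (\<Inter>a \<in> I. var_ideal R (A a))" (is ?inter)
    and "standard_primary_decomposition R (monomial_ideal R U) I (\<lambda>a. var_ideal R (A a))"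
proof -
  let ?Q = "\<lambda>a. var_ideal R (A a)"
  interpret R: cring R unfolding R_def by (rule cring_poly_ring)
  have J: "monomial_ideal R U = {f \<in> carrier R. \<forall>u \<in> Poly_Mapping.keys f. \<exists>m \<in> U. \<exists>w. u = w + m}"
    unfolding R_def using U by (rule monomial_ideal_eq)
  have Q: "?Q a = {f \<in> carrier R. \<forall>u \<in> Poly_Mapping.keys f. Poly_Mapping.keys u \<inter> A a \<noteq> {}}"
    if "a \<in> I" for a
    unfolding R_def using A[OF that] by (rule var_ideal_eq)
  have prime: "primeideal (?Q a) R" if "a \<in> I" for a
    unfolding R_def using A[OF that] by (rule var_ideal_prime)
  have divides: "\<exists>m \<in> U. \<exists>w. u = w + m"
    if u: "Poly_Mapping.keys u \<subseteq> {1..n}" "\<And>a. a \<in> I \<Longrightarrow> Poly_Mapping.keys u \<inter> A a \<noteq> {}" for u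
  proof -
    \<comment> \<open>The indices outside \<open>u\<close> contain no \<open>A a\<close>, so they do
      not form a cover; a generator that they miss has its support inside that of
      \<open>u\<close>.\<close>
    have "\<not> (\<forall>m \<in> U. Poly_Mapping.keys m \<inter> ({1..n} - Poly_Mapping.keys u) \<noteq> {})"
      using covers_contain[of "{1..n} - Poly_Mapping.keys u"] u(2) by blast
    then obtain m where m: "m \<in> U" "Poly_Mapping.keys m \<subseteq> Poly_Mapping.keys u"
      using U by blast
    \<comment> \<open>As \<open>m\<close> is squarefree, inclusion of supports already gives
      divisibility.\<close>
    have "Poly_Mapping.lookup m x \<le> Poly_Mapping.lookup u x" for x
    proof (cases "x \<in> Poly_Mapping.keys m")
      case True
      then have "Poly_Mapping.lookup u x \<noteq> 0" using m(2) by (blast dest: in_keys_iff[THEN iffD1])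
      then show ?thesis using sqfree[OF m(1), of x] by linarith
    qed (simp add: in_keys_iff)
    then have "u = (u - m) + m"
      by (intro poly_mapping_eqI) (simp add: lookup_add lookup_minus)
    then show ?thesis using m(1) by blast
  qed
  show inter: ?inter
  proof
    show "monomial_ideal R U \<subseteq> carrier R \<inter> (\<Inter>a \<in> I. ?Q a)"
      unfolding J using cover by (fastforce simp: Q keys_add_nat)
    show "carrier R \<inter> (\<Inter>a \<in> I. ?Q a) \<subseteq> monomial_ideal R U"
    proof
      fix f assume f: "f \<in> carrier R \<inter> (\<Inter>a \<in> I. ?Q a)"
      have "\<exists>m \<in> U. \<exists>w. u = w + m" if u: "u \<in> Poly_Mapping.keys f" for u
      proof (rule divides)
        show "Poly_Mapping.keys u \<subseteq> {1..n}" using f u by (simp add: R_def)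
        fix a assume a: "a \<in> I"
        then have "f \<in> ?Q a" using f by blast
        then show "Poly_Mapping.keys u \<inter> A a \<noteq> {}" using u by (simp add: Q[OF a])
      qed
      then show "f \<in> monomial_ideal R U" unfolding J using f by blast
    qed
  qed
  have mono: "A a \<subseteq> A b" if "a \<in> I" "b \<in> I" "?Q a \<subseteq> ?Q b" for a b
  proof
    fix i assume i: "i \<in> A a"
    then have "mon_poly (Poly_Mapping.single i 1) \<in> ?Q a"
      using A[OF that(1)] unfolding Q[OF that(1)] by (auto simp: R_def mon_poly_def)
    then have "mon_poly (Poly_Mapping.single i 1) \<in> ?Q b" using that(3) by blast
    then show "i \<in> A b" by (simp add: Q[OF that(2)] mon_poly_def)
  qed
  have inj: "a = b" if "a \<in> I" "b \<in> I" "?Q a \<subseteq> ?Q b" for a b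
    using incomparable mono that by blast
  have irredundant: "\<not> carrier R \<inter> (\<Inter>b \<in> I - {a}. ?Q b) \<subseteq> ?Q a" if a: "a \<in> I" for a
  proof -
    \<comment> \<open>The product of all variables outside \<open>A a\<close> avoids
      \<open>?Q a\<close>, but by incomparability it lies in every other ideal of the
      family.\<close>
    define u where "u = (\<Sum>i \<in> {1..n} - A a. Poly_Mapping.single i (1::nat))"
    have u: "Poly_Mapping.keys u = {1..n} - A a"
      by (auto simp: u_def in_keys_iff lookup_sum lookup_single when_def sum.delta split: if_splits)
    have "mon_poly u \<in> carrier R" "mon_poly u \<notin> ?Q a"
      unfolding Q[OF a] using u by (auto simp: R_def mon_poly_def)
    moreover have "mon_poly u \<in> ?Q b" if b: "b \<in> I - {a}" for b
    proof -
      have "\<not> A b \<subseteq> A a" using incomparable[of b a] a b by blast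
      then have "Poly_Mapping.keys u \<inter> A b \<noteq> {}"
        using A[of b] b u by blast
      moreover have "b \<in> I" using b by blast
      ultimately show ?thesis
        unfolding Q[OF \<open>b \<in> I\<close>] using u by (auto simp: R_def mon_poly_def)
    qed
    ultimately show ?thesis by blast
  qed
  have contains: "\<exists>a \<in> I. ?Q a \<subseteq> P" if P: "primeideal P R" "monomial_ideal R U \<subseteq> P" for P
  proof -
    interpret P: primeideal P R by fact
    \<comment> \<open>By primality every generator has a variable in \<open>P\<close>, so the
      variables in \<open>P\<close> form a cover, which contains some \<open>A a\<close>.\<close>
    define C where "C = {i \<in> {1..n}. mon_poly (Poly_Mapping.single i 1) \<in> P}"
    have "Poly_Mapping.keys m \<inter> C \<noteq> {}" if m: "m \<in> U" for m
    proof -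
      have "\<exists>m' \<in> U. \<exists>w. m = w + m'" using m by (metis add.left_neutral)
      then have "mon_poly m \<in> monomial_ideal R U"
        using U[OF m] by (simp add: J) (simp add: R_def mon_poly_def)
      then have "\<exists>i \<in> Poly_Mapping.keys m. mon_poly (Poly_Mapping.single i 1) \<in> P"
        using primeideal_mon_poly[of P n m] P U[OF m] unfolding R_def by blast
      then show ?thesis using U[OF m] unfolding C_def by blast
    qed
    then obtain a where a: "a \<in> I" "A a \<subseteq> C"
      using covers_contain[of C] unfolding C_def by blast
    have "?Q a \<subseteq> P"
      unfolding var_ideal_def
      by (rule R.genideal_minimal) (use a P.is_ideal in \<open>auto simp: C_def\<close>)
    with a show ?thesis by blast
  qed
  have J_sub: "monomial_ideal R U \<subseteq> ?Q a" if "a \<in> I" for a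
    using inter that by blast
  have "?Q ` I = minimal_primes R (monomial_ideal R U)"
  proof
    show "?Q ` I \<subseteq> minimal_primes R (monomial_ideal R U)"
    proof
      fix P assume "P \<in> ?Q ` I"
      then obtain a where a: "a \<in> I" "P = ?Q a" by blast
      have "Q' = P" if Q': "primeideal Q' R" "monomial_ideal R U \<subseteq> Q'" "Q' \<subseteq> P" for Q'
      proof -
        \<comment> \<open>Then \<open>?Q b\<close> lies below \<open>?Q a\<close>; incomparability
          gives \<open>b = a\<close>, and \<open>Q'\<close> is squeezed between equal
          ideals.\<close>
        obtain b where "b \<in> I" "?Q b \<subseteq> Q'" using contains[OF Q'(1,2)] by blast
        moreover then have "b = a" using inj[of b a] a Q'(3) by blast
        ultimately show ?thesis using a Q'(3) by blast
      qed
      then show "P \<in> minimal_primes R (monomial_ideal R U)"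
        using a J_sub[of a] prime[of a] by (auto simp: minimal_primes_def)
    qed
    show "minimal_primes R (monomial_ideal R U) \<subseteq> ?Q ` I"
    proof
      fix P assume P: "P \<in> minimal_primes R (monomial_ideal R U)"
      then obtain a where "a \<in> I" "?Q a \<subseteq> P"
        using contains[of P] by (auto simp: minimal_primes_def)
      then show "P \<in> ?Q ` I"
        using P prime[of a] J_sub[of a] by (auto simp: minimal_primes_def)
    qed
  qed
  moreover have "inj_on (\<lambda>a. ideal_radical R (?Q a)) I"
    using inj primeideal.ideal_radical_eq[OF prime] by (intro inj_onI) simp
  ultimately show "standard_primary_decomposition R (monomial_ideal R U) I ?Q"
    unfolding standard_primary_decomposition_def minimal_primary_decomposition_def
    by (intro conjI ballI fin inter irredundant primeideal_imp_primary_ideal prime)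
qed

section \<open>Index sequences of squarefree and \<open>t\<close>-spread monomials\<close>

text \<open>Index sequences are total functions of which only the values on \<open>{1..k}\<close>
  count, so they are compared only on this range.\<close>

definition spread_seq :: "nat \<Rightarrow> nat \<Rightarrow> (nat \<Rightarrow> nat) \<Rightarrow> bool" where
  "spread_seq t k i \<longleftrightarrow> (\<forall>r \<in> {1..<k}. i r + t \<le> i (Suc r))"

definition lex_less :: "nat \<Rightarrow> (nat \<Rightarrow> nat) \<Rightarrow> (nat \<Rightarrow> nat) \<Rightarrow> bool" where
  "lex_less k i j \<longleftrightarrow> (\<exists>s \<in> {1..k}. (\<forall>r \<in> {1..<s}. i r = j r) \<and> i s < j s)"

lemma spread_seqD:
  assumes "spread_seq t k i" "1 \<le> r" "r < s" "s \<le> k"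
  shows "i r + t \<le> i s"
  using assms(3,4)
proof (induction s)
  case (Suc s)
  then have "i s + t \<le> i (Suc s)" using assms(1,2) by (auto simp: spread_seq_def)
  moreover have "r = s \<or> i r + t \<le> i s" using Suc by fastforce
  ultimately show ?case by auto
qed simp

lemma spread_seq_strict_mono: "t \<ge> 1 \<Longrightarrow> spread_seq t k i \<Longrightarrow> strict_mono_on {1..k} i"
  by (rule strict_mono_onI) (use spread_seqD in fastforce)

lemma xprod_cong: "(\<And>r. r \<in> {1..k} \<Longrightarrow> i r = i' r) \<Longrightarrow> xprod i k = xprod i' k"
  unfolding xprod_def by (rule sum.cong) auto

lemma lookup_xprod:
  "Poly_Mapping.lookup (xprod i k) x = card {r \<in> {1..k}. i r = x}"
  by (simp add: xprod_def lookup_sum lookup_single when_def sum.If_cases Int_def conj_commute)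

lemma keys_xprod: "Poly_Mapping.keys (xprod i k) = i ` {1..k}"
  by (auto simp: in_keys_iff lookup_xprod)

lemma mon_degree_xprod: "mon_degree (xprod i k) = k"
proof -
  \<comment> \<open>The degree counts positions by value: the fibres of \<open>i\<close> partition
    \<open>{1..k}\<close>.\<close>
  have "mon_degree (xprod i k) = card (\<Union>x \<in> i ` {1..k}. {r \<in> {1..k}. i r = x})"
    unfolding mon_degree_def keys_xprod lookup_xprod by (rule card_UN_disjoint[symmetric]) auto
  also have "(\<Union>x \<in> i ` {1..k}. {r \<in> {1..k}. i r = x}) = {1..k}" by auto
  finally show ?thesis by simp
qed

lemma lookup_xprod_le_1:
  assumes "strict_mono_on {1..k} i"
  shows "Poly_Mapping.lookup (xprod i k) x \<le> 1"
proof -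
  have "inj_on i {1..k}" using assms by (rule strict_mono_on_imp_inj_on)
  then have "card {r \<in> {1..k}. i r = x} \<le> Suc 0"
    by (subst card_le_Suc0_iff_eq) (auto dest: inj_onD)
  then show ?thesis by (simp add: lookup_xprod)
qed

text \<open>Induction on the position. If, say, \<open>i r < j r\<close>, then \<open>i r\<close>
  equals some \<open>j s\<close>. For \<open>s < r\<close> the sequences agree at \<open>s\<close>,
  against strictness of \<open>i\<close>; for \<open>s \<ge> r\<close> the value \<open>j s\<close>
  is too large.\<close>

lemma strict_mono_image_eq:
  fixes i j :: "nat \<Rightarrow> nat"
  assumes "strict_mono_on {1..k} i" "strict_mono_on {1..k} j" "i ` {1..k} = j ` {1..k}" "r \<in> {1..k}"
  shows "i r = j r"
  using assms(4)
proof (induction r rule: less_induct)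
  case (less r)
  have *: "\<not> f r < g r"
    if f: "strict_mono_on {1..k} f" and g: "strict_mono_on {1..k} g" and img: "f ` {1..k} = g ` {1..k}"
      and eq: "\<And>s. s \<in> {1..k} \<Longrightarrow> s < r \<Longrightarrow> f s = g s" for f g :: "nat \<Rightarrow> nat"
  proof
    assume fg: "f r < g r"
    obtain s where s: "s \<in> {1..k}" "f r = g s" using img less.prems by blast
    show False
    proof (cases "s < r")
      case True
      then show False using eq[OF s(1)] strict_mono_onD[OF f s(1) less.prems] s(2) by simp
    next
      case False
      then show False using strict_mono_on_leD[OF g less.prems s(1)] s(2) fg by simp
    qed
  qed
  have "i s = j s" if "s \<in> {1..k}" "s < r" for s using less.IH that by blast
  then show ?case
    using *[OF assms(1,2,3)] *[OF assms(2,1) assms(3)[symmetric]] by (metis nat_neq_iff)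
qed

text \<open>The degree recovers the length and the support recovers the set of values; together they
  determine an increasing sequence.\<close>

lemma xprod_eqD:
  assumes "xprod i k = xprod j l" "strict_mono_on {1..k} i" "strict_mono_on {1..l} j"
  shows "k = l" and "r \<in> {1..k} \<Longrightarrow> i r = j r"
proof -
  show kl: "k = l" using assms(1) mon_degree_xprod by metis
  assume "r \<in> {1..k}"
  moreover have "i ` {1..k} = j ` {1..k}" using assms(1) kl keys_xprod by metis
  ultimately show "i r = j r" using strict_mono_image_eq assms(2,3) kl by blast
qed

lemma spread_monomials_iff:
  "u \<in> spread_monomials m d t \<longleftrightarrow> (\<exists>i. u = xprod i d \<and> spread_seq t d i \<and> i ` {1..d} \<subseteq> {1..m})"
proof -
  have "spread_seq t k i \<longleftrightarrow> (\<forall>r \<in> {1..<k}. i r \<le> i (Suc r) \<and> i r + t \<le> i (Suc r))" for k i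
    by (auto simp: spread_seq_def dest: add_leD1)
  then have "u \<in> spread_monomials m d t \<longleftrightarrow>
      (\<exists>k i. u = xprod i k \<and> spread_seq t k i \<and> mon_degree u = d \<and> Poly_Mapping.keys u \<subseteq> {1..m})"
    unfolding spread_monomials_def t_spread_def by blast
  also have "\<dots> \<longleftrightarrow> (\<exists>k i. u = xprod i k \<and> spread_seq t k i \<and> k = d \<and> i ` {1..k} \<subseteq> {1..m})"
    using mon_degree_xprod keys_xprod by metis
  finally show ?thesis by blast
qed

text \<open>\<open>slex_gt\<close> asks for some pair of increasing index sequences; by uniqueness
  any given pair decides it.\<close>

lemma slex_gt_xprod_iff:
  assumes "strict_mono_on {1..k} i" "strict_mono_on {1..k} j"
  shows "slex_gt (xprod i k) (xprod j k) \<longleftrightarrow> lex_less k i j"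
proof
  assume "slex_gt (xprod i k) (xprod j k)"
  then obtain l i' j' where *: "xprod i k = xprod i' l" "xprod j k = xprod j' l"
    "strict_mono_on {1..l} i'" "strict_mono_on {1..l} j'" "lex_less l i' j'"
    unfolding slex_gt_def lex_less_def by blast
  have "k = l" using xprod_eqD(1)[OF *(1) assms(1) *(3)] .
  moreover have "i r = i' r" "j r = j' r" if "r \<in> {1..k}" for r
    using xprod_eqD(2)[OF *(1) assms(1) *(3) that] xprod_eqD(2)[OF *(2) assms(2) *(4) that] .
  ultimately show "lex_less k i j" using *(5) by (fastforce simp: lex_less_def)
next
  assume "lex_less k i j"
  then show "slex_gt (xprod i k) (xprod j k)"
    unfolding slex_gt_def lex_less_def using assms by blast
qed

text \<open>The lexsegment in terms of index sequences. Agreement with \<open>j\<close> on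
  \<open>{1..d}\<close> takes the place of equality of monomials.\<close>

definition lexsegment_seqs :: "nat \<Rightarrow> nat \<Rightarrow> nat \<Rightarrow> (nat \<Rightarrow> nat) \<Rightarrow> (nat \<Rightarrow> nat) set" where
  "lexsegment_seqs n d t j =
     {i. spread_seq t d i \<and> i ` {1..d} \<subseteq> {1..n} \<and> ((\<forall>r \<in> {1..d}. i r = j r) \<or> lex_less d i j)}"

lemma init_lexsegment_eq:
  assumes t: "t \<ge> 1" and j: "spread_seq t d j"
  shows "init_lexsegment n d t (xprod j d) = (\<lambda>i. xprod i d) ` lexsegment_seqs n d t j"
proof (intro subset_antisym subsetI)
  fix u assume u: "u \<in> init_lexsegment n d t (xprod j d)"
  then obtain i where i: "u = xprod i d" "spread_seq t d i" "i ` {1..d} \<subseteq> {1..n}"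
    unfolding init_lexsegment_def spread_monomials_iff by blast
  note mono = spread_seq_strict_mono[OF t i(2)] spread_seq_strict_mono[OF t j]
  have "(\<forall>r \<in> {1..d}. i r = j r) \<or> lex_less d i j"
  proof (cases "u = xprod j d")
    case True
    then have "xprod i d = xprod j d" using i(1) by simp
    then show ?thesis using xprod_eqD(2)[OF _ mono] by blast
  next
    case False
    then show ?thesis using u i(1) slex_gt_xprod_iff[OF mono] by (auto simp: init_lexsegment_def)
  qed
  with i show "u \<in> (\<lambda>i. xprod i d) ` lexsegment_seqs n d t j"
    unfolding lexsegment_seqs_def by blast
next
  fix u assume "u \<in> (\<lambda>i. xprod i d) ` lexsegment_seqs n d t j"
  then obtain i where i: "u = xprod i d" "spread_seq t d i" "i ` {1..d} \<subseteq> {1..n}"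
    "(\<forall>r \<in> {1..d}. i r = j r) \<or> lex_less d i j"
    unfolding lexsegment_seqs_def by blast
  note mono = spread_seq_strict_mono[OF t i(2)] spread_seq_strict_mono[OF t j]
  show "u \<in> init_lexsegment n d t (xprod j d)"
    unfolding init_lexsegment_def spread_monomials_iff
    using i slex_gt_xprod_iff[OF mono] xprod_cong[of d i j] by blast
qed

text \<open>Rewrites the monomial that bounds the family \<open>\<F>\<close>: dividing by the last
  variable drops the last index.\<close>

lemma xprod_delete_max:
  assumes "strict_mono_on {1..d} j" "d \<ge> 1"
  shows "xprod j d - Poly_Mapping.single (max_index (xprod j d)) 1 = xprod j (d - 1)"
proof -
  have "max_index (xprod j d) = j d"
    unfolding max_index_def keys_xprod
  proof (rule Max_eqI)
    fix y assume "y \<in> j ` {1..d}"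
    then show "y \<le> j d" using strict_mono_on_leD[OF assms(1)] assms(2) by auto
  qed (use assms(2) in auto)
  moreover have "xprod j d = xprod j (d - 1) + Poly_Mapping.single (j d) 1"
    using assms(2) by (cases d) (simp_all add: xprod_def)
  ultimately show ?thesis by simp
qed

section \<open>Unions of blocks of length \<open>t\<close>\<close>

definition blocks :: "nat \<Rightarrow> nat \<Rightarrow> (nat \<Rightarrow> nat) \<Rightarrow> nat set" where
  "blocks t k w = (\<Union>r \<in> {1..k}. {w r..<w r + t})"

text \<open>For \<open>t \<ge> 1\<close> the truncated \<open>t - 1\<close> is exact, so the closed
  intervals of \<open>supp_t\<close> become half-open ones.\<close>

lemma supp_t_xprod: "t \<ge> 1 \<Longrightarrow> supp_t t (xprod w k) = blocks t k w"
  unfolding supp_t_def blocks_def keys_xprod by fastforce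

section \<open>The minimal covers of a lexsegment\<close>

text \<open>Pigeonhole: entries of \<open>i\<close> are at least \<open>t\<close> apart, so a block
  of length \<open>t\<close> holds at most one of them.\<close>

lemma spread_seq_not_subset_blocks:
  assumes "spread_seq t d i" "k < d"
  shows "\<not> i ` {1..d} \<subseteq> blocks t k w"
proof
  assume sub: "i ` {1..d} \<subseteq> blocks t k w"
  have "\<exists>s \<in> {1..k}. i r \<in> {w s..<w s + t}" if "r \<in> {1..d}" for r
    using sub that unfolding blocks_def by fast
  then obtain b where b: "\<And>r. r \<in> {1..d} \<Longrightarrow> b r \<in> {1..k} \<and> i r \<in> {w (b r)..<w (b r) + t}" by metis
  have "b r \<noteq> b s" if "r \<in> {1..d}" "s \<in> {1..d}" "r < s" for r s
    using b[OF that(1)] b[OF that(2)] spread_seqD[OF assms(1), of r s] that by auto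
  then have "inj_on b {1..d}" by (metis inj_onI nat_neq_iff)
  moreover have "b ` {1..d} \<subseteq> {1..k}" using b by blast
  ultimately have "card {1..d} \<le> card {1..k}" by (intro card_inj_on_le) auto
  with assms(2) show False by simp
qed

text \<open>The inserted sequence uses the left ends of the blocks before \<open>x\<close> and the right ends of
  those after \<open>x\<close>.\<close>

lemma insert_into_blocks:
  assumes w: "spread_seq t k w" and t: "t \<ge> 1" and x: "x \<notin> blocks t k w"
  obtains i r where "r \<le> k" "spread_seq t (Suc k) i" "\<And>s. s \<in> {1..r} \<Longrightarrow> i s = w s" "i (Suc r) = x"
    "\<And>s. s \<in> {Suc (Suc r)..Suc k} \<Longrightarrow> i s = w (s - 1) + (t - 1)"
    "\<And>s. s \<in> {Suc r..k} \<Longrightarrow> x < w s"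
    "i ` {1..Suc k} \<subseteq> insert x (blocks t k w)"
proof -
  have alt: "w s + t \<le> x \<or> x < w s" if "s \<in> {1..k}" for s
  proof (rule ccontr)
    assume "\<not> ?thesis"
    then have "x \<in> blocks t k w" using that unfolding blocks_def by (intro UN_I) auto
    with x show False ..
  qed
  have "\<exists>r \<le> k. (\<forall>s \<in> {1..r}. w s + t \<le> x) \<and> (\<forall>s \<in> {Suc r..k}. x < w s)"
  proof (cases "\<exists>s \<in> {1..k}. x < w s")
    case True
    \<comment> \<open>\<open>q\<close> is the first block starting after \<open>x\<close>; all
      earlier blocks end before \<open>x\<close>, and all later ones start even further
      right.\<close>
    define q where "q = (LEAST s. s \<in> {1..k} \<and> x < w s)"
    have "q \<in> {1..k} \<and> x < w q"
      unfolding q_def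
      by (rule LeastI_ex[where P = "\<lambda>s. s \<in> {1..k} \<and> x < w s"]) (use True in blast)
    then have q: "q \<in> {1..k}" "x < w q" by blast+
    have least: "q \<le> s" if "s \<in> {1..k}" "x < w s" for s
      unfolding q_def by (rule Least_le) (use that in blast)
    show ?thesis
    proof (intro exI[of _ "q - 1"] conjI ballI)
      fix s assume s: "s \<in> {1..q - 1}"
      then show "w s + t \<le> x" using alt[of s] least[of s] q by fastforce
    next
      fix s assume "s \<in> {Suc (q - 1)..k}"
      then show "x < w s" using q spread_seqD[OF w, of q s] by (cases "s = q") auto
    qed (use q in auto)
  next
    case False
    then show ?thesis using alt by (intro exI[of _ k]) auto
  qed
  then obtain r where r: "r \<le> k" "\<And>s. s \<in> {1..r} \<Longrightarrow> w s + t \<le> x" "\<And>s. s \<in> {Suc r..k} \<Longrightarrow> x < w s"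
    by blast
  define i where "i s = (if s \<le> r then w s else if s = Suc r then x else w (s - 1) + (t - 1))" for s
  have "i (Suc r) = x" by (simp add: i_def)
  show thesis
  proof (rule that[of r i])
    show "spread_seq t (Suc k) i"
      unfolding spread_seq_def
    proof
      fix s assume s: "s \<in> {1..<Suc k}"
      consider "Suc s \<le> r" | "s = r" | "s = Suc r" | "s > Suc r" by linarith
      then show "i s + t \<le> i (Suc s)"
      proof cases
        case 1
        then show ?thesis using s r(1) spread_seqD[OF w, of s "Suc s"] by (auto simp: i_def)
      next
        case 2
        then show ?thesis using s r(2)[of s] by (auto simp: i_def)
      next
        case 3
        \<comment> \<open>From \<open>x < w s\<close> the right end \<open>w s + (t - 1)\<close> is
          at least \<open>x + t\<close>; the left end might be too close to
          \<open>x\<close>.\<close>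
        then show ?thesis using s r(3)[of s] t by (auto simp: i_def)
      next
        case 4
        then show ?thesis using s spread_seqD[OF w, of "s - 1" s] by (auto simp: i_def)
      qed
    qed
    show "i ` {1..Suc k} \<subseteq> insert x (blocks t k w)"
    proof
      fix y assume "y \<in> i ` {1..Suc k}"
      then obtain s where s: "s \<in> {1..Suc k}" "y = i s" by blast
      have "\<exists>q \<in> {1..k}. i s \<in> {w q..<w q + t}" if "s \<noteq> Suc r"
      proof (rule bexI)
        show "i s \<in> {w (if s \<le> r then s else s - 1)..<w (if s \<le> r then s else s - 1) + t}"
          using that t by (auto simp: i_def)
        show "(if s \<le> r then s else s - 1) \<in> {1..k}" using s r(1) that by auto
      qed
      then show "y \<in> insert x (blocks t k w)"
        using s \<open>i (Suc r) = x\<close> unfolding blocks_def by blast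
    qed
  qed (use r in \<open>auto simp: i_def\<close>)
qed

lemma lex_lessI:
  "1 \<le> s \<Longrightarrow> s \<le> k \<Longrightarrow> (\<And>r. 1 \<le> r \<Longrightarrow> r < s \<Longrightarrow> i r = j r) \<Longrightarrow> i s < j s \<Longrightarrow> lex_less k i j"
  unfolding lex_less_def by (intro bexI[of _ s]) auto

text \<open>Taking in turn the first element of \<open>D\<close> that is at least \<open>t\<close> above the previous choice covers
  \<open>D\<close> by blocks. Capping the \<open>r\<close>-th choice at \<open>c r\<close> leaves room for the blocks still to come.\<close>

lemma greedy_blocks:
  assumes D: "D \<subseteq> {1..n}" and k: "k \<ge> 1" "k * t \<le> n"
  obtains a where "spread_seq t k a" "a ` {1..k} \<subseteq> {1..n + 1 - t}"
    "\<And>x r. x \<in> D \<Longrightarrow> r \<in> {1..k} \<Longrightarrow> x \<notin> blocks t (r - 1) a \<Longrightarrow> a r \<le> x"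
    "\<And>x. x \<in> D \<Longrightarrow> x \<notin> blocks t k a \<Longrightarrow> a k + t \<le> x \<and> a ` {1..k} \<subseteq> D"
proof -
  \<comment> \<open>\<open>c r\<close> is the start of the \<open>r\<close>-th block when blocks
    \<open>r\<close> to \<open>k\<close> are packed against \<open>n\<close>. Since
    \<open>k * t \<le> n\<close>, the subtraction is exact.\<close>
  define c where "c r = n + 1 - (k + 1 - r) * t" for r
  \<comment> \<open>\<open>b r\<close> is the first position after block \<open>r\<close>, from
    which the next search starts. The recursion runs on these bounds, and \<open>a\<close> reads off
    the choices.\<close>
  define b where "b = rec_nat 1 (\<lambda>r p. (LEAST y. p \<le> y \<and> (y \<in> D \<or> y = c (Suc r))) + t)"
  define a where "a r = (LEAST y. b (r - 1) \<le> y \<and> (y \<in> D \<or> y = c r))" for r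
  have b0: "b 0 = 1" and bS: "b (Suc r) = a (Suc r) + t" for r
    by (simp_all add: b_def a_def)
  have cS: "c (Suc r) = c r + t" if "r \<in> {1..k}" for r
  proof -
    have "(k + 1 - r) * t = (k - r) * t + t" using that by (simp add: Suc_diff_le)
    moreover have "(k + 1 - r) * t \<le> k * t" using that by (intro mult_le_mono1) auto
    ultimately show ?thesis using k(2) that by (simp add: c_def)
  qed
  have b_le: "b r \<le> c (Suc r)" if "r < k" for r
    using that
  proof (induction r)
    case 0
    then show ?case using k by (simp add: b0 c_def)
  next
    case (Suc r)
    then have "a (Suc r) \<le> c (Suc r)" unfolding a_def by (intro Least_le) simp
    then show ?case using bS cS[of "Suc r"] Suc.prems by simp
  qed
  have a: "b (r - 1) \<le> a r" "a r \<in> D \<or> a r = c r" "a r \<le> c r" if r: "r \<in> {1..k}" for r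
  proof -
    have le: "b (r - 1) \<le> c r" using b_le[of "r - 1"] r by auto
    then have "b (r - 1) \<le> a r \<and> (a r \<in> D \<or> a r = c r)"
      unfolding a_def
      by (intro LeastI[where P = "\<lambda>y. b (r - 1) \<le> y \<and> (y \<in> D \<or> y = c r)" and k = "c r"]) simp
    then show "b (r - 1) \<le> a r" "a r \<in> D \<or> a r = c r" by blast+
    show "a r \<le> c r" unfolding a_def by (rule Least_le) (use le in simp)
  qed
  have a_least: "a r \<le> x" if "x \<in> D" "b (r - 1) \<le> x" for x r
    unfolding a_def by (rule Least_le) (use that in simp)
  have spread: "spread_seq t k a"
    unfolding spread_seq_def
  proof
    fix r assume r: "r \<in> {1..<k}"
    then have "b r = a r + t" using bS[of "r - 1"] by simp
    then show "a r + t \<le> a (Suc r)" using a(1)[of "Suc r"] r by simp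
  qed
  have cover: "x \<in> blocks t r a \<or> b r \<le> x" if x: "x \<in> D" and "r \<le> k" for x r
    using that(2)
  proof (induction r)
    case 0
    then show ?case using x D b0 by auto
  next
    case (Suc r)
    show ?case
    proof (cases "x \<in> blocks t r a")
      case False
      then have "a (Suc r) \<le> x" using Suc a_least[OF x, of "Suc r"] by simp
      then show ?thesis
        by (cases "x < a (Suc r) + t") (auto simp: blocks_def bS)
    qed (auto simp: blocks_def)
  qed
  have last: "b k = a k + t" using bS[of "k - 1"] k(1) by simp
  show thesis
  proof (rule that[OF spread])
    show "a ` {1..k} \<subseteq> {1..n + 1 - t}"
    proof
      fix y assume "y \<in> a ` {1..k}"
      then obtain r where r: "r \<in> {1..k}" "y = a r" by blast
      have "a 1 \<ge> 1" using a(1)[of 1] b0 k(1) by simp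
      moreover have "a 1 \<le> a r" using spread_seqD[OF spread, of 1 r] r by (cases "r = 1") auto
      moreover have "a r \<le> a k" using spread_seqD[OF spread, of r k] r by (cases "r = k") auto
      moreover have "a k \<le> n + 1 - t" using a(3)[of k] k(1) by (simp add: c_def)
      ultimately show "y \<in> {1..n + 1 - t}" using r by simp
    qed
  next
    fix x r assume "x \<in> D" "r \<in> {1..k}" "x \<notin> blocks t (r - 1) a"
    then show "a r \<le> x" using cover[of x "r - 1"] a_least by auto
  next
    fix x assume x: "x \<in> D" "x \<notin> blocks t k a"
    then have "b k \<le> x" using cover[of x k] by simp
    then have le: "a k + t \<le> x" using last by simp
    have "a r \<in> D" if r: "r \<in> {1..k}" for r
    proof (rule ccontr)
      assume "a r \<notin> D"
      then have "a r = c r" using a(2)[OF r] by blast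
      \<comment> \<open>Once a choice sits at its cap, the gaps force all later ones to theirs. The
        last block then ends at \<open>n\<close> and leaves no room for \<open>x\<close>.\<close>
      have "a s = c s" if "r \<le> s" "s \<le> k" for s
        using that
      proof (induction s rule: dec_induct)
        case base
        then show ?case using \<open>a r = c r\<close> by simp
      next
        case (step s)
        then have "c (Suc s) \<le> a (Suc s)"
          using cS[of s] r spread_seqD[OF spread, of s "Suc s"] by auto
        then show ?case using a(3)[of "Suc s"] step r by auto
      qed
      then have "a k = c k" using r by simp
      then have "a k + t = n + 1" using cS[of k] k by (simp add: c_def)
      then show False using le x D by auto
    qed
    with le show "a k + t \<le> x \<and> a ` {1..k} \<subseteq> D" by blast
  qed
qed

section \<open>The two families of covers: the sets \<open>F p\<close>, and the complements of the
  sets in \<open>\<F>\<close>\<close>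

definition initial_cover :: "nat \<Rightarrow> (nat \<Rightarrow> nat) \<Rightarrow> nat \<Rightarrow> nat set" where
  "initial_cover t j p = {1..j p} - blocks t (p - 1) j"

definition lex_block_sets :: "nat \<Rightarrow> nat \<Rightarrow> nat \<Rightarrow> (nat \<Rightarrow> nat) \<Rightarrow> nat set set" where
  "lex_block_sets n k t j =
     {blocks t k w | w. spread_seq t k w \<and> w ` {1..k} \<subseteq> {1..n + 1 - t} \<and> lex_less k w j}"

text \<open>Blocks at \<open>j r\<close> with \<open>r < s\<close> end before \<open>i s\<close>
  because \<open>i\<close> agrees with \<open>j\<close> there; the other removed blocks start after
  \<open>i s\<close>. This gives both that generators meet \<open>F p\<close> and that
  \<open>F p\<close> meets every set in \<open>\<F>\<close>.\<close>

lemma lex_mem_initial_cover: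
  assumes j: "spread_seq t d j" and p: "p \<le> d" and i: "spread_seq t k i"
    and s: "1 \<le> s" "s \<le> k" "s \<le> p" "\<And>r. r \<in> {1..<s} \<Longrightarrow> i r = j r" "i s \<le> j s" "s = p \<or> i s < j s"
    and pos: "1 \<le> i s"
  shows "i s \<in> initial_cover t j p"
proof -
  have "i s \<notin> {j r..<j r + t}" if "r \<in> {1..p - 1}" for r
  proof (cases "r < s")
    case True
    then show ?thesis using spread_seqD[OF i, of r s] s that by auto
  next
    case False
    then have "i s < j s" "j s \<le> j r"
      using that s(6) spread_seqD[OF j, of s r] s(1) p by (cases "r = s"; force)+
    then show ?thesis by simp
  qed
  moreover have "j s \<le> j p" using spread_seqD[OF j, of s p] s p by (cases "s = p") auto
  ultimately show ?thesis using s(5) pos by (auto simp: initial_cover_def blocks_def)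
qed

lemma initial_cover_meets:
  assumes j: "spread_seq t d j" and p: "p \<in> {1..d}" and i: "i \<in> lexsegment_seqs n d t j"
  shows "i ` {1..d} \<inter> initial_cover t j p \<noteq> {}"
proof -
  have i': "spread_seq t d i" "i ` {1..d} \<subseteq> {1..n}" "(\<forall>r \<in> {1..d}. i r = j r) \<or> lex_less d i j"
    using i by (auto simp: lexsegment_seqs_def)
  \<comment> \<open>Take the first position where \<open>i\<close> and \<open>j\<close> differ if it
    is at most \<open>p\<close>, and \<open>p\<close> otherwise.\<close>
  have "\<exists>s \<in> {1..p}. (\<forall>r \<in> {1..<s}. i r = j r) \<and> i s \<le> j s \<and> (s = p \<or> i s < j s)"
    using i'(3)
  proof
    assume "\<forall>r \<in> {1..d}. i r = j r"
    then show ?thesis using p by (intro bexI[of _ p]) auto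
  next
    assume "lex_less d i j"
    then obtain s where s: "s \<in> {1..d}" "\<forall>r \<in> {1..<s}. i r = j r" "i s < j s"
      unfolding lex_less_def by blast
    show ?thesis
    proof (cases "s \<le> p")
      case True
      then show ?thesis using s by (intro bexI[of _ s]) auto
    next
      case False
      then show ?thesis using s(2) p by (intro bexI[of _ p]) auto
    qed
  qed
  then obtain s where s: "s \<in> {1..p}" "\<forall>r \<in> {1..<s}. i r = j r" "i s \<le> j s" "s = p \<or> i s < j s"
    by blast
  have "i s \<in> initial_cover t j p"
  proof (rule lex_mem_initial_cover[OF j _ i'(1)])
    show "1 \<le> i s" using i'(2) s(1) p by (simp add: image_subset_iff)
  qed (use s p in auto)
  moreover have "s \<in> {1..d}" using s(1) p by simp
  ultimately show ?thesis by blast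
qed

text \<open>Insert \<open>x\<close> into the blocks at the first \<open>p - 1\<close> entries of
  \<open>j\<close> and resume \<open>j\<close> at \<open>p + 1\<close>. The first \<open>p\<close>
  entries lie in removed blocks or equal \<open>x\<close>; the later ones exceed
  \<open>j p\<close>.\<close>

lemma initial_cover_minimal:
  assumes j: "spread_seq t d j" "j ` {1..d} \<subseteq> {1..n}" and t: "t \<ge> 1" and p: "p \<in> {1..d}"
    and x: "x \<in> initial_cover t j p"
  shows "\<exists>i \<in> lexsegment_seqs n d t j. i ` {1..d} \<inter> (initial_cover t j p - {x}) = {}"
proof -
  have x': "1 \<le> x" "x \<le> j p" "x \<notin> blocks t (p - 1) j"
    using x by (auto simp: initial_cover_def)
  have "spread_seq t (p - 1) j" using j(1) p by (auto simp: spread_seq_def)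
  then obtain i r where i: "r \<le> p - 1" "spread_seq t (Suc (p - 1)) i"
      "\<And>s. s \<in> {1..r} \<Longrightarrow> i s = j s" "i (Suc r) = x"
      "\<And>s. s \<in> {Suc (Suc r)..Suc (p - 1)} \<Longrightarrow> i s = j (s - 1) + (t - 1)"
      "\<And>s. s \<in> {Suc r..p - 1} \<Longrightarrow> x < j s"
      "i ` {1..Suc (p - 1)} \<subseteq> insert x (blocks t (p - 1) j)"
    using insert_into_blocks[OF _ t x'(3)] by metis
  have Sp: "Suc (p - 1) = p" using p by simp
  define i' where "i' s = (if s \<le> p then i s else j s)" for s
  \<comment> \<open>This keeps the gap at the junction: the entry at \<open>p\<close> is either
    \<open>x\<close> or the right end of the block at \<open>j (p - 1)\<close>.\<close>
  have i_p: "i p \<le> j p"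
  proof (cases "Suc r = p")
    case True
    then show ?thesis using i(4) x'(2) by auto
  next
    case False
    then have "i p = j (p - 1) + (t - 1)" using i(1,5) p by auto
    moreover have "1 \<le> p - 1" "p - 1 < p" using p i(1) False by auto
    ultimately show ?thesis using spread_seqD[OF j(1), of "p - 1" p] p by auto
  qed
  have spread: "spread_seq t d i'"
    unfolding spread_seq_def
  proof
    fix s assume s: "s \<in> {1..<d}"
    then have "j s + t \<le> j (Suc s)" using spread_seqD[OF j(1), of s "Suc s"] by simp
    moreover have "i s + t \<le> i (Suc s)" if "Suc s \<le> p"
      using spread_seqD[OF i(2)[unfolded Sp], of s "Suc s"] s that by simp
    ultimately show "i' s + t \<le> i' (Suc s)"
      using i_p by (cases "s = p") (auto simp: i'_def)
  qed
  have i'_sub: "i' s \<in> insert x (blocks t (p - 1) j)" if "s \<in> {1..p}" for s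
    using i(7) that by (simp add: i'_def Sp image_subset_iff)
  have "i' s \<in> {1..n}" if s: "s \<in> {1..d}" for s
  proof (cases "s \<le> p")
    case True
    have "j q \<ge> 1" if "q \<in> {1..p - 1}" for q
      using j(2) that p by (auto simp: image_subset_iff)
    then have "y \<ge> 1" if "y \<in> insert x (blocks t (p - 1) j)" for y
      using that x'(1) unfolding blocks_def by fastforce
    then have "1 \<le> i' s" using i'_sub[of s] True s by auto
    moreover have "i' s \<le> i' p"
      using spread_seqD[OF spread, of s p] True s p by (cases "s = p") auto
    moreover have "i' p \<le> j p" using i_p by (simp add: i'_def)
    moreover have "j p \<le> n" using j(2) p by (simp add: image_subset_iff)
    ultimately show ?thesis by auto
  next
    case False
    then show ?thesis using j(2) s by (simp add: i'_def image_subset_iff)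
  qed
  then have range: "i' ` {1..d} \<subseteq> {1..n}" by blast
  have r: "Suc r \<le> p" "i' (Suc r) = x" "\<And>s. s \<in> {1..r} \<Longrightarrow> i' s = j s"
    using i(1,3,4) p by (auto simp: i'_def)
  \<comment> \<open>Position \<open>r + 1\<close> decides. If \<open>x\<close> is not below
    \<open>j (r + 1)\<close>, then it was inserted last and equals \<open>j p\<close>, so the
    sequence is \<open>j\<close> itself.\<close>
  have "(\<forall>s \<in> {1..d}. i' s = j s) \<or> lex_less d i' j"
  proof (cases "x < j (Suc r)")
    case True
    have "lex_less d i' j"
      by (rule lex_lessI[of "Suc r"]) (use True r p in auto)
    then show ?thesis ..
  next
    case False
    have "Suc r = p"
    proof (rule ccontr)
      assume "Suc r \<noteq> p"
      then have "Suc r \<in> {Suc r..p - 1}" using r(1) by auto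
      then show False using i(6) False by blast
    qed
    then have "x = j p" using False x'(2) by simp
    have "i' s = j s" if "s \<in> {1..d}" for s
    proof -
      consider "s \<le> r" | "s = p" | "s > p" using \<open>Suc r = p\<close> by linarith
      then show ?thesis
        using r(2,3) \<open>Suc r = p\<close> \<open>x = j p\<close> that by cases (auto simp: i'_def)
    qed
    then show ?thesis by blast
  qed
  then have "i' \<in> lexsegment_seqs n d t j"
    using spread range by (simp add: lexsegment_seqs_def)
  moreover have "i' s \<notin> initial_cover t j p - {x}" if s: "s \<in> {1..d}" for s
  proof (cases "s \<le> p")
    case True
    then show ?thesis using i'_sub[of s] s by (auto simp: initial_cover_def)
  next
    case False
    then have "j p < i' s" using spread_seqD[OF j(1), of p s] s p t by (auto simp: i'_def)
    then show ?thesis by (auto simp: initial_cover_def)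
  qed
  ultimately show ?thesis by blast
qed

lemma blocks_subset:
  assumes "w ` {1..k} \<subseteq> {1..n + 1 - t}"
  shows "blocks t k w \<subseteq> {1..n}"
proof -
  have "{w r..<w r + t} \<subseteq> {1..n}" if "r \<in> {1..k}" for r
  proof -
    have "w r \<in> {1..n + 1 - t}" using assms that by blast
    then show ?thesis by auto
  qed
  then show ?thesis unfolding blocks_def by blast
qed

lemma block_complement_meets:
  assumes "i \<in> lexsegment_seqs n d t j" "k < d"
  shows "i ` {1..d} \<inter> ({1..n} - blocks t k w) \<noteq> {}"
  using assms spread_seq_not_subset_blocks[of t d i k w] by (auto simp: lexsegment_seqs_def)

text \<open>Inserting \<open>x\<close> into the \<open>d - 1\<close> blocks gives \<open>d\<close>
  indices of which only \<open>x\<close> lies outside the blocks; the result still precedes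
  \<open>j\<close>.\<close>

lemma block_complement_minimal:
  assumes d: "d \<ge> 1" and t: "t \<ge> 1"
    and w: "spread_seq t (d - 1) w" "w ` {1..d - 1} \<subseteq> {1..n + 1 - t}" "lex_less (d - 1) w j"
    and x: "x \<in> {1..n} - blocks t (d - 1) w"
  shows "\<exists>i \<in> lexsegment_seqs n d t j. i ` {1..d} \<inter> ({1..n} - blocks t (d - 1) w - {x}) = {}"
proof -
  have "x \<notin> blocks t (d - 1) w" using x by blast
  from insert_into_blocks[OF w(1) t this]
  obtain i r where i: "r \<le> d - 1" "spread_seq t (Suc (d - 1)) i"
      "\<And>s. s \<in> {1..r} \<Longrightarrow> i s = w s" "i (Suc r) = x"
      "\<And>s. s \<in> {Suc r..d - 1} \<Longrightarrow> x < w s"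
      "i ` {1..Suc (d - 1)} \<subseteq> insert x (blocks t (d - 1) w)"
    by metis
  have Sd: "Suc (d - 1) = d" using d by simp
  obtain s where s: "s \<in> {1..d - 1}" "\<forall>q \<in> {1..<s}. w q = j q" "w s < j s"
    using w(3) unfolding lex_less_def by blast
  \<comment> \<open>A first difference at \<open>s \<le> r\<close> survives the insertion. Otherwise
    position \<open>r + 1\<close> holds \<open>x\<close>, which is below \<open>w (r + 1)\<close>
    and hence below \<open>j (r + 1)\<close>.\<close>
  have "lex_less d i j"
  proof (cases "s \<le> r")
    case True
    show ?thesis
      by (rule lex_lessI[of s]) (use True s i(1,3) in auto)
  next
    case False
    have "w (Suc r) \<le> j (Suc r)" using s False by (cases "Suc r = s") auto
    moreover have "x < w (Suc r)" using i(5) False s(1) by simp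
    ultimately show ?thesis
      by (intro lex_lessI[of "Suc r"]) (use False s i(1,3,4) in auto)
  qed
  then have "i \<in> lexsegment_seqs n d t j"
    using i(2,6) x blocks_subset[OF w(2)] unfolding Sd lexsegment_seqs_def by blast
  then show ?thesis using i(6) unfolding Sd by blast
qed

text \<open>Greedy block starts \<open>a\<close> for the complement of \<open>C\<close> are compared
  with the first \<open>d - 1\<close> entries of \<open>j\<close>. Agreement yields
  \<open>F d\<close>; at the first difference \<open>p\<close>, a larger entry yields
  \<open>F p\<close> and a smaller one a union of blocks from \<open>\<F>\<close>.\<close>

lemma cover_contains_minimal_cover:
  assumes j: "spread_seq t d j" "j ` {1..d} \<subseteq> {1..n}" and t: "t \<ge> 1" and d: "d \<ge> 2"
    and C: "C \<subseteq> {1..n}" "\<And>i. i \<in> lexsegment_seqs n d t j \<Longrightarrow> i ` {1..d} \<inter> C \<noteq> {}"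
  shows "(\<exists>p \<in> {1..d}. initial_cover t j p \<subseteq> C) \<or> (\<exists>G \<in> lex_block_sets n (d - 1) t j. {1..n} - G \<subseteq> C)"
proof -
  define D where "D = {1..n} - C"
  have no_seq: False if "i \<in> lexsegment_seqs n d t j" "i ` {1..d} \<subseteq> D" for i
    using C(2)[OF that(1)] that(2) by (auto simp: D_def)
  \<comment> \<open>The gaps of \<open>j\<close> show that \<open>d - 1\<close> blocks fit:
    \<open>(d - 1) * t \<le> j d \<le> n\<close>.\<close>
  have "r * t \<le> j (Suc r)" if "Suc r \<le> d" for r
    using that
  proof (induction r)
    case (Suc r)
    then show ?case using spread_seqD[OF j(1), of "Suc r" "Suc (Suc r)"] by simp
  qed simp
  from this[of "d - 1"] have "(d - 1) * t \<le> j d" using d by simp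
  also have jd: "j d \<le> n" using j(2) d by (simp add: image_subset_iff)
  finally have "(d - 1) * t \<le> n" .
  moreover have "D \<subseteq> {1..n}" "1 \<le> d - 1" using d by (auto simp: D_def)
  ultimately obtain a where a: "spread_seq t (d - 1) a" "a ` {1..d - 1} \<subseteq> {1..n + 1 - t}"
    "\<And>x r. x \<in> D \<Longrightarrow> r \<in> {1..d - 1} \<Longrightarrow> x \<notin> blocks t (r - 1) a \<Longrightarrow> a r \<le> x"
    "\<And>x. x \<in> D \<Longrightarrow> x \<notin> blocks t (d - 1) a \<Longrightarrow> a (d - 1) + t \<le> x \<and> a ` {1..d - 1} \<subseteq> D"
    using greedy_blocks[of D n "d - 1" t] by metis
  \<comment> \<open>An uncovered \<open>x\<close> in \<open>D\<close> forces all greedy choices into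
    \<open>D\<close>; appending \<open>x\<close> then gives a generator that \<open>C\<close>
    misses, provided it belongs to the lexsegment.\<close>
  have extend: False
    if x: "x \<in> D" "x \<notin> blocks t (d - 1) a"
      and lex: "(\<forall>r \<in> {1..d}. (a(d := x)) r = j r) \<or> lex_less d (a(d := x)) j" for x
  proof -
    have sub: "a(d := x) ` {1..d} \<subseteq> D" using a(4)[OF x] x(1) by (auto simp: image_subset_iff)
    have "spread_seq t d (a(d := x))"
      unfolding spread_seq_def
    proof
      fix r assume r: "r \<in> {1..<d}"
      show "(a(d := x)) r + t \<le> (a(d := x)) (Suc r)"
      proof (cases "Suc r = d")
        case True
        then have "r = d - 1" by simp
        then show ?thesis using a(4)[OF x] True by simp
      next
        case False
        then show ?thesis using r spread_seqD[OF a(1), of r "Suc r"] by auto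
      qed
    qed
    then have "a(d := x) \<in> lexsegment_seqs n d t j"
      using sub lex by (auto simp: lexsegment_seqs_def D_def)
    then show False using no_seq sub by blast
  qed
  have blocks_cong: "blocks t k a = blocks t k j" if "\<And>r. r \<in> {1..k} \<Longrightarrow> a r = j r" for k
    using that by (simp add: blocks_def)
  show ?thesis
  proof (cases "\<forall>r \<in> {1..d - 1}. a r = j r")
    case True
    \<comment> \<open>A missing \<open>x\<close> is at most \<open>j d\<close>, so appending it to
      \<open>a\<close> gives \<open>j\<close> itself or a sequence preceding
      \<open>j\<close>.\<close>
    have "initial_cover t j d \<subseteq> C"
    proof (rule ccontr)
      assume "\<not> ?thesis"
      then obtain x where x: "x \<in> initial_cover t j d" "x \<notin> C" by blast
      then have "x \<in> D" "x \<notin> blocks t (d - 1) a" "x \<le> j d"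
        using jd blocks_cong[of "d - 1"] True by (auto simp: D_def initial_cover_def)
      moreover have "(\<forall>r \<in> {1..d}. (a(d := x)) r = j r) \<or> lex_less d (a(d := x)) j"
      proof (cases "x = j d")
        case False
        have "lex_less d (a(d := x)) j"
          by (rule lex_lessI[of d]) (use False \<open>x \<le> j d\<close> True d in auto)
        then show ?thesis ..
      qed (use True in auto)
      ultimately show False using extend by blast
    qed
    then show ?thesis using d by (intro disjI1 bexI[of _ d]) auto
  next
    case False
    define p where "p = (LEAST r. r \<in> {1..d - 1} \<and> a r \<noteq> j r)"
    have "p \<in> {1..d - 1} \<and> a p \<noteq> j p"
      unfolding p_def
      by (rule LeastI_ex[where P = "\<lambda>r. r \<in> {1..d - 1} \<and> a r \<noteq> j r"]) (use False in blast)
    then have p: "p \<in> {1..d - 1}" "a p \<noteq> j p" by blast+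
    have eq: "a r = j r" if "r \<in> {1..<p}" for r
    proof (rule ccontr)
      assume "a r \<noteq> j r"
      then have "p \<le> r" unfolding p_def using that p(1) by (intro Least_le) auto
      then show False using that by simp
    qed
    show ?thesis
    proof (cases "a p < j p")
      case True
      have lex: "lex_less (d - 1) a j"
        by (rule lex_lessI[of p]) (use p(1) eq True in auto)
      \<comment> \<open>Appending any \<open>x\<close> keeps the difference at \<open>p\<close>, so
        the extended sequence would always be in the lexsegment.\<close>
      have "D \<subseteq> blocks t (d - 1) a"
      proof (rule ccontr)
        assume "\<not> ?thesis"
        then obtain x where "x \<in> D" "x \<notin> blocks t (d - 1) a" by blast
        moreover have "lex_less d (a(d := x)) j"
          by (rule lex_lessI[of p]) (use p(1) eq True in auto)
        ultimately show False using extend by blast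
      qed
      then have "{1..n} - blocks t (d - 1) a \<subseteq> C" by (auto simp: D_def)
      moreover have "blocks t (d - 1) a \<in> lex_block_sets n (d - 1) t j"
        unfolding lex_block_sets_def using a(1,2) lex by blast
      ultimately show ?thesis by blast
    next
      case False
      \<comment> \<open>Here \<open>a p > j p\<close>, while a missing \<open>x \<le> j p\<close>
        was available to the greedy choice and would give \<open>a p \<le> x\<close>.\<close>
      have "initial_cover t j p \<subseteq> C"
      proof (rule ccontr)
        assume "\<not> ?thesis"
        then obtain x where x: "x \<in> initial_cover t j p" "x \<notin> C" by blast
        have "j p \<le> n" using j(2) p(1) by (auto simp: image_subset_iff)
        moreover have "blocks t (p - 1) a = blocks t (p - 1) j"
          by (rule blocks_cong) (use eq in auto)
        ultimately have "x \<in> D" "x \<notin> blocks t (p - 1) a" "x \<le> j p"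
          using x by (auto simp: D_def initial_cover_def)
        then show False using a(3)[of x p] p False by auto
      qed
      then show ?thesis using p(1) by (intro disjI1 bexI[of _ p]) auto
    qed
  qed
qed

text \<open>For \<open>p < q\<close>, the index \<open>j p\<close> lies in \<open>F p\<close> but is
  removed from \<open>F q\<close>. Each \<open>F p\<close> meets every \<open>G\<close> in
  \<open>\<F>\<close>, so it is not the complement of \<open>G\<close>; and subsets of
  \<open>{1..n}\<close> are determined by their complements.\<close>

lemma minimal_covers_distinct:
  fixes j :: "nat \<Rightarrow> nat"
  assumes j: "spread_seq t d j" "j ` {1..d} \<subseteq> {1..n}" and t: "t \<ge> 1"
  shows "inj_on (case_sum (initial_cover t j) (\<lambda>G. {1..n} - G)) ({1..d} <+> lex_block_sets n (d - 1) t j)"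
proof -
  have F: "initial_cover t j p \<noteq> initial_cover t j q" if "p \<in> {1..d}" "q \<in> {1..d}" "p < q" for p q
  proof -
    have "j p \<notin> {j r..<j r + t}" if "r \<in> {1..p - 1}" for r
      using spread_seqD[OF j(1), of r p] that \<open>p \<in> {1..d}\<close> by (cases "r < p") auto
    moreover have "1 \<le> j p" using j(2) that by (simp add: image_subset_iff)
    ultimately have "j p \<in> initial_cover t j p"
      unfolding initial_cover_def blocks_def by auto
    moreover have "j p \<in> blocks t (q - 1) j"
      unfolding blocks_def using that t by (intro UN_I[of p]) auto
    then have "j p \<notin> initial_cover t j q" by (simp add: initial_cover_def)
    ultimately show ?thesis by blast
  qed
  have FG: "initial_cover t j p \<inter> G \<noteq> {}" if p: "p \<in> {1..d}" and G: "G \<in> lex_block_sets n (d - 1) t j" for p G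
  proof -
    obtain w where w: "G = blocks t (d - 1) w" "spread_seq t (d - 1) w" "w ` {1..d - 1} \<subseteq> {1..n + 1 - t}"
      "lex_less (d - 1) w j" using G unfolding lex_block_sets_def by blast
    obtain s where s: "s \<in> {1..d - 1}" "\<forall>q \<in> {1..<s}. w q = j q" "w s < j s"
      using w(4) unfolding lex_less_def by blast
    \<comment> \<open>The witness is the smaller of \<open>s\<close> and \<open>p\<close>; if it is
      \<open>p\<close>, then \<open>p < s \<le> d - 1\<close> keeps it in range.\<close>
    have "\<exists>r \<in> {1..d - 1}. r \<le> p \<and> (\<forall>q \<in> {1..<r}. w q = j q) \<and> w r \<le> j r \<and> (r = p \<or> w r < j r)"
    proof (cases "s \<le> p")
      case True
      then show ?thesis using s by (intro bexI[of _ s]) auto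
    next
      case False
      then show ?thesis using s p by (intro bexI[of _ p]) auto
    qed
    then obtain r where r: "r \<in> {1..d - 1}" "r \<le> p" "\<forall>q \<in> {1..<r}. w q = j q" "w r \<le> j r"
      "r = p \<or> w r < j r" by blast
    have "w r \<in> initial_cover t j p"
    proof (rule lex_mem_initial_cover[OF j(1) _ w(2)])
      show "1 \<le> w r" using w(3) r(1) by (simp add: image_subset_iff)
    qed (use r p in auto)
    moreover have "w r \<in> G"
      unfolding w(1) blocks_def using r(1) t by (intro UN_I[of r]) auto
    ultimately show ?thesis by blast
  qed
  have G_sub: "G \<subseteq> {1..n}" if "G \<in> lex_block_sets n (d - 1) t j" for G
    using that blocks_subset unfolding lex_block_sets_def by blast
  show ?thesis
  proof (rule inj_onI)
    fix a b
    assume ab: "a \<in> {1..d} <+> lex_block_sets n (d - 1) t j" "b \<in> {1..d} <+> lex_block_sets n (d - 1) t j"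
      and eq: "case_sum (initial_cover t j) (\<lambda>G. {1..n} - G) a = case_sum (initial_cover t j) (\<lambda>G. {1..n} - G) b"
    show "a = b"
    proof (cases a; cases b)
      fix p q assume "a = Inl p" "b = Inl q"
      then show ?thesis using F[of p q] F[of q p] ab eq by (cases p q rule: linorder_cases) auto
    next
      fix p G assume "a = Inl p" "b = Inr G"
      moreover then have "initial_cover t j p \<inter> G \<noteq> {}" using FG ab by blast
      ultimately show ?thesis using eq by auto
    next
      fix p G assume "a = Inr G" "b = Inl p"
      moreover then have "initial_cover t j p \<inter> G \<noteq> {}" using FG ab by blast
      ultimately show ?thesis using eq by auto
    next
      fix G H assume GH: "a = Inr G" "b = Inr H"
      then have "{1..n} - G = {1..n} - H" using eq by simp
      moreover have "G \<subseteq> {1..n}" "H \<subseteq> {1..n}" using G_sub ab GH by blast+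
      ultimately show ?thesis using GH by blast
    qed
  qed
qed

theorem theorem2p1:
  fixes n t d :: nat
    and j :: "nat \<Rightarrow> nat"
    and v :: monomial
    and S :: "(monomial \<Rightarrow>\<^sub>0 'k::field) ring"
    and J :: "(monomial \<Rightarrow>\<^sub>0 'k) set"
    and F :: "nat \<Rightarrow> nat set"
    and \<F> :: "nat set set"
  assumes "n \<ge> 1" and "t \<ge> 1" and "d \<ge> 2"
    and "strict_mono_on {1..d} j" and "v = xprod j d" and "v \<in> spread_monomials n d t"
    and "j 1 \<ge> 2"
    and "S = poly_ring n"
    and "J = monomial_ideal S (init_lexsegment n d t v)"
    and "\<And>p. F p = {1..j p} - supp_t t (xprod j (p - 1))"
    and "\<F> = {supp_t t w | w. w \<in> spread_monomials (n + 1 - t) (d - 1) t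
                \<and> slex_gt w (v - Poly_Mapping.single (max_index v) 1)}"
  shows "J = (\<Inter>p \<in> {1..d}. var_ideal S (F p)) \<inter> (\<Inter>G \<in> \<F>. var_ideal S ({1..n} - G))
    \<and> standard_primary_decomposition S J ({1..d} <+> \<F>)
        (case_sum (\<lambda>p. var_ideal S (F p)) (\<lambda>G. var_ideal S ({1..n} - G)))"
proof -
  note t = \<open>t \<ge> 1\<close>
  \<comment> \<open>Membership of \<open>v\<close> provides some spread index sequence; uniqueness
    of increasing sequences identifies it with \<open>j\<close>.\<close>
  have j: "spread_seq t d j" "j ` {1..d} \<subseteq> {1..n}"
  proof -
    obtain i where i: "xprod j d = xprod i d" "spread_seq t d i" "i ` {1..d} \<subseteq> {1..n}"
      using \<open>v \<in> spread_monomials n d t\<close> unfolding \<open>v = xprod j d\<close> spread_monomials_iff by blast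
    have "j r = i r" if "r \<in> {1..d}" for r
      using xprod_eqD(2)[OF i(1) \<open>strict_mono_on {1..d} j\<close> spread_seq_strict_mono[OF t i(2)] that] .
    then show "spread_seq t d j" "j ` {1..d} \<subseteq> {1..n}"
      using i(2,3) by (simp_all add: spread_seq_def image_subset_iff)
  qed
  have F: "F = initial_cover t j"
    using assms(10) by (simp add: fun_eq_iff initial_cover_def supp_t_xprod[OF t])
  have j': "strict_mono_on {1..d - 1} j"
    using \<open>strict_mono_on {1..d} j\<close> by (rule monotone_on_subset) auto
  have "v - Poly_Mapping.single (max_index v) 1 = xprod j (d - 1)"
    using xprod_delete_max[OF \<open>strict_mono_on {1..d} j\<close>] \<open>d \<ge> 2\<close> \<open>v = xprod j d\<close> by simp
  then have F_slex: "\<F> = {supp_t t w | w. w \<in> spread_monomials (n + 1 - t) (d - 1) t \<and> slex_gt w (xprod j (d - 1))}"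
    using assms(11) by simp
  have \<F>: "\<F> = lex_block_sets n (d - 1) t j"
  proof
    show "\<F> \<subseteq> lex_block_sets n (d - 1) t j"
    proof
      fix G assume "G \<in> \<F>"
      then obtain w where w: "G = supp_t t (xprod w (d - 1))" "spread_seq t (d - 1) w"
          "w ` {1..d - 1} \<subseteq> {1..n + 1 - t}" "slex_gt (xprod w (d - 1)) (xprod j (d - 1))"
        unfolding F_slex spread_monomials_iff by blast
      then show "G \<in> lex_block_sets n (d - 1) t j"
        unfolding lex_block_sets_def supp_t_xprod[OF t]
        using slex_gt_xprod_iff[OF spread_seq_strict_mono[OF t w(2)] j'] by blast
    qed
    show "lex_block_sets n (d - 1) t j \<subseteq> \<F>"
    proof
      fix G assume "G \<in> lex_block_sets n (d - 1) t j"
      then obtain w where w: "G = blocks t (d - 1) w" "spread_seq t (d - 1) w"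
          "w ` {1..d - 1} \<subseteq> {1..n + 1 - t}" "lex_less (d - 1) w j"
        unfolding lex_block_sets_def by blast
      then show "G \<in> \<F>"
        unfolding F_slex spread_monomials_iff supp_t_xprod[OF t, symmetric]
        using slex_gt_xprod_iff[OF spread_seq_strict_mono[OF t w(2)] j'] by blast
    qed
  qed
  define U where "U = init_lexsegment n d t v"
  have U: "U = (\<lambda>i. xprod i d) ` lexsegment_seqs n d t j"
    unfolding U_def \<open>v = xprod j d\<close> by (rule init_lexsegment_eq[OF t j(1)])
  \<comment> \<open>The disjoint sum keeps the two families apart as indices, so irredundancy also
    rules out a set shared by both.\<close>
  define I where "I = {1..d} <+> \<F>"
  define A where "A = case_sum F (\<lambda>G. {1..n} - G)"
  have meets: "i ` {1..d} \<inter> A a \<noteq> {}" if a: "a \<in> I" and i: "i \<in> lexsegment_seqs n d t j" for a i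
  proof (cases a)
    case (Inl p)
    then have "p \<in> {1..d}" using a by (auto simp: I_def)
    then show ?thesis using initial_cover_meets[OF j(1) _ i] by (simp add: A_def F Inl)
  next
    case (Inr G)
    then obtain w where "G = blocks t (d - 1) w"
      using a unfolding I_def \<F> lex_block_sets_def by blast
    then show ?thesis
      using block_complement_meets[OF i, of "d - 1"] \<open>d \<ge> 2\<close> by (simp add: A_def Inr)
  qed
  have minimal: "\<exists>i \<in> lexsegment_seqs n d t j. i ` {1..d} \<inter> (A a - {x}) = {}"
    if a: "a \<in> I" and x: "x \<in> A a" for a x
  proof (cases a)
    case (Inl p)
    then have "p \<in> {1..d}" using a by (auto simp: I_def)
    then show ?thesis using initial_cover_minimal[OF j t] x by (simp add: A_def F Inl)
  next
    case (Inr G)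
    then obtain w where "G = blocks t (d - 1) w" "spread_seq t (d - 1) w"
      "w ` {1..d - 1} \<subseteq> {1..n + 1 - t}" "lex_less (d - 1) w j"
      using a unfolding I_def \<F> lex_block_sets_def by blast
    then show ?thesis
      using block_complement_minimal[of d t w n j x] t \<open>d \<ge> 2\<close> x by (simp add: A_def Inr)
  qed
  have A_sub: "A a \<subseteq> {1..n}" if "a \<in> I" for a
    using that j(2) unfolding I_def A_def F initial_cover_def by (auto simp: image_subset_iff)
  have "\<F> \<subseteq> Pow {1..n}"
    using blocks_subset unfolding \<F> lex_block_sets_def by blast
  then have finite_I: "finite I" unfolding I_def by (auto intro: finite_subset)
  have U_keys: "Poly_Mapping.keys m \<subseteq> {1..n}" if "m \<in> U" for m
    using that unfolding U by (auto simp: lexsegment_seqs_def keys_xprod simp del: One_nat_def)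
  have U_sqfree: "Poly_Mapping.lookup m x \<le> 1" if "m \<in> U" for m x
    using that lookup_xprod_le_1 spread_seq_strict_mono[OF t] unfolding U lexsegment_seqs_def by blast
  have cover: "Poly_Mapping.keys m \<inter> A a \<noteq> {}" if "a \<in> I" "m \<in> U" for a m
    using that meets unfolding U by (auto simp: keys_xprod simp del: One_nat_def)
  have contains: "\<exists>a \<in> I. A a \<subseteq> C"
    if C: "C \<subseteq> {1..n}" and meets_C: "\<And>m. m \<in> U \<Longrightarrow> Poly_Mapping.keys m \<inter> C \<noteq> {}" for C
  proof -
    have "i ` {1..d} \<inter> C \<noteq> {}" if "i \<in> lexsegment_seqs n d t j" for i
      using meets_C[of "xprod i d"] that unfolding U keys_xprod by blast
    from cover_contains_minimal_cover[OF j t \<open>d \<ge> 2\<close> C this] show ?thesis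
    proof
      assume "\<exists>p \<in> {1..d}. initial_cover t j p \<subseteq> C"
      then obtain p where "p \<in> {1..d}" "initial_cover t j p \<subseteq> C" by blast
      then show ?thesis by (intro bexI[of _ "Inl p"]) (auto simp: A_def F I_def)
    next
      assume "\<exists>G \<in> lex_block_sets n (d - 1) t j. {1..n} - G \<subseteq> C"
      then obtain G where "G \<in> \<F>" "{1..n} - G \<subseteq> C" unfolding \<F> by blast
      then show ?thesis by (intro bexI[of _ "Inr G"]) (auto simp: A_def I_def)
    qed
  qed
  have incomparable: "a = b" if ab: "a \<in> I" "b \<in> I" "A a \<subseteq> A b" for a b
  proof -
    have "A b \<subseteq> A a"
    proof
      fix x assume x: "x \<in> A b"
      \<comment> \<open>This generator meets \<open>A b\<close> at most in \<open>x\<close>, yet it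
        meets the subset \<open>A a\<close>; hence \<open>x\<close> lies in
        \<open>A a\<close>.\<close>
      obtain i where i: "i \<in> lexsegment_seqs n d t j" "i ` {1..d} \<inter> (A b - {x}) = {}"
        using minimal[OF ab(2) x] by blast
      show "x \<in> A a" using meets[OF ab(1) i(1)] i(2) ab(3) by blast
    qed
    with ab show ?thesis
      using minimal_covers_distinct[OF j t] unfolding A_def I_def F \<F> by (blast dest: inj_onD)
  qed
  note decomposition =
    squarefree_standard_primary_decomposition[OF finite_I U_keys U_sqfree A_sub cover contains incomparable]
  have "J = carrier S \<inter> (\<Inter>a \<in> I. var_ideal S (A a))"
    unfolding assms(9) U_def[symmetric] \<open>S = poly_ring n\<close> by (rule decomposition(1))
  moreover have "standard_primary_decomposition S J I (\<lambda>a. var_ideal S (A a))"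
    unfolding assms(9) U_def[symmetric] \<open>S = poly_ring n\<close> by (rule decomposition(2))
  \<comment> \<open>The component for \<open>F 1\<close> lies in the ring, so the intersection with
    the carrier is absorbed.\<close>
  moreover have "var_ideal S (A (Inl 1)) \<subseteq> carrier S"
  proof -
    have "Inl 1 \<in> I" using \<open>d \<ge> 2\<close> by (auto simp: I_def)
    then show ?thesis unfolding \<open>S = poly_ring n\<close> using var_ideal_eq[OF A_sub] by blast
  qed
  moreover have "(\<lambda>a. var_ideal S (A a)) = case_sum (\<lambda>p. var_ideal S (F p)) (\<lambda>G. var_ideal S ({1..n} - G))"
    by (auto simp: A_def fun_eq_iff split: sum.split)
  moreover have "(\<Inter>a \<in> I. var_ideal S (A a)) =
      (\<Inter>p \<in> {1..d}. var_ideal S (F p)) \<inter> (\<Inter>G \<in> \<F>. var_ideal S ({1..n} - G))"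
    by (simp add: I_def A_def Plus_def INT_Un)
  moreover have "(\<Inter>p \<in> {1..d}. var_ideal S (F p)) \<subseteq> var_ideal S (A (Inl 1))"
    using \<open>d \<ge> 2\<close> by (auto simp: A_def)
  ultimately show ?thesis unfolding I_def by auto
qed

end
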